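(* Let $n\in\mathbb{N}$, $n\ge 1$, and $0<\alpha<2$. Let $G_{\alpha,1,n}(\mathrm{x},t)$ be the fundamental solution of the space-fractional diffusion equation $$\frac{\partial u}{\partial t}(\mathrm{x},t)=-(-\Delta)^{\frac{\alpha}{2}}u(\mathrm{x},t),\quad \mathrm{x}\in\mathbb{R}^n,\ t>0,$$ and let $G_{2,1,n}(\mathrm{x},t)=\frac{1}{(\sqrt{4\pi t})^{n}}\exp\left(-\frac{|\mathrm{x}|^{2}}{4t}\right)$ be the fundamental solution of the conventional diffusion equation. Then for all $\mathrm{x}\in\mathbb{R}^n\setminus\{0\}$ and $t>0$, $$G_{\alpha,1,n}(\mathrm{x},t)=\int_0^\infty s^{-1}\,W_{0,-\frac{\alpha}{2}}\left(-s^{-\frac{\alpha}{2}}t\right)\,G_{2,1,n}(\mathrm{x},s)\,ds.$$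
   Context: Wright function: for $\mu>-1$ and $a,z\in\mathbb{C}$, $$W_{a,\mu}(z)=\sum_{k=0}^\infty\frac{z^k}{k!\,\Gamma(a+\mu k)},$$ with the convention that $1/\Gamma$ is the entire reciprocal Gamma function (equal to $0$ at $0,-1,-2,\dots$). The fractional Laplacian $(-\Delta)^{\frac{\alpha}{2}}$ is the pseudo-differential operator with symbol $|\kappa|^\alpha$, with respect to the Fourier transform $\hat f(\kappa)=\int_{\mathbb{R}^n}e^{i\kappa\cdot\mathrm{x}}f(\mathrm{x})\,d\mathrm{x}$. The fundamental solution $G_{\alpha,1,n}$ is the solution of the equation with initial condition $u(\mathrm{x},0)=\prod_{i=1}^n\delta(x_i)$ ($\delta$ the Dirac delta function). Equivalently, for each $t>0$, $G_{\alpha,1,n}(\cdot,t)$ is the continuous function on $\mathbb{R}^n$ whose Fourier transform in $\mathrm{x}$ is $\hat G_{\alpha,1,n}(\kappa,t)=e^{-|\kappa|^\alpha t}$. *)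

theory Defs
  imports "HOL-Analysis.Analysis"
begin

definition Wright :: "complex \<Rightarrow> real \<Rightarrow> complex \<Rightarrow> complex" where
  "Wright a \<mu> z = (\<Sum>k. z ^ k / fact k * rGamma (a + of_real \<mu> * of_nat k))"

definition fourier :: "(real ^ 'n \<Rightarrow> complex) \<Rightarrow> real ^ 'n \<Rightarrow> complex" where
  "fourier f \<kappa> = (LINT x|lborel. exp (\<i> * of_real (\<kappa> \<bullet> x)) * f x)"

(* Fundamental solution of u_t = -(-Laplacian)^(alpha/2) u with u(.,0) = Dirac delta, where the
   fractional Laplacian has symbol norm kappa powr alpha: for each t > 0, G(.,t) is the continuous
   function with Fourier transform exp(-t * norm kappa powr alpha).  Integrability is required
   explicitly because the integral defining fourier is 0 by convention otherwise.
   The lemma fundamental_solution_iff_Cauchy below relates this to the equation itself. *)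
definition fundamental_solution :: "real \<Rightarrow> (real ^ 'n \<Rightarrow> real \<Rightarrow> complex) \<Rightarrow> bool" where
  "fundamental_solution \<alpha> G \<longleftrightarrow>
     (\<forall>t>0. continuous_on UNIV (\<lambda>x. G x t) \<and> integrable lborel (\<lambda>x. G x t) \<and>
        (\<forall>\<kappa>. fourier (\<lambda>x. G x t) \<kappa> = of_real (exp (- (norm \<kappa> powr \<alpha>) * t))))"

definition heat_kernel :: "real ^ 'n \<Rightarrow> real \<Rightarrow> real" where
  "heat_kernel x t = 1 / sqrt (4 * pi * t) ^ CARD('n) * exp (- (norm x)\<^sup>2 / (4 * t))"

lemma exp_ode_unique:
  fixes y :: "real \<Rightarrow> complex"
  assumes d: "\<And>t. t > 0 \<Longrightarrow> (y has_vector_derivative - of_real c * y t) (at t)"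
    and l: "(y \<longlongrightarrow> 1) (at_right 0)" and t: "t > 0"
  shows "y t = of_real (exp (- c * t))"
proof -
  define h where "h t = exp (c * t) *\<^sub>R y t" for t
  have h': "(h has_vector_derivative 0) (at s)" if "s > 0" for s
  proof -
    have "((\<lambda>t. exp (c * t)) has_real_derivative exp (c * s) * c) (at s)"
      by (rule DERIV_cong, (rule derivative_intros)+) simp
    from has_vector_derivative_scaleR[OF this d[OF that]]
    show ?thesis unfolding h_def by (simp add: scaleR_conv_of_real)
  qed
  obtain k where k: "\<And>s. s \<in> {0<..} \<Longrightarrow> h s = k"
    by (rule has_vector_derivative_zero_constant[of "{0<..}" h])
       (use h' in \<open>auto intro: has_vector_derivative_at_within\<close>)
  have "(h \<longlongrightarrow> exp (c * 0) *\<^sub>R 1) (at_right 0)"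
    unfolding h_def by (intro tendsto_intros l)
  moreover have "(h \<longlongrightarrow> k) (at_right 0)"
    by (rule tendsto_eventually) (auto simp: k intro!: eventually_at_rightI[of 0 1])
  ultimately have "exp (c * 0) *\<^sub>R 1 = k"
    by (rule tendsto_unique[OF trivial_limit_at_right_real])
  then have "exp (c * t) *\<^sub>R y t = 1" using k[of t] t by (simp add: h_def)
  then have "y t = inverse (of_real (exp (c * t)))"
    by (simp add: scaleR_conv_of_real inverse_unique[symmetric])
  then show ?thesis by (simp add: exp_minus)
qed

lemma fundamental_solution_iff_Cauchy:
  fixes G :: "real ^ 'n \<Rightarrow> real \<Rightarrow> complex"
  shows "fundamental_solution \<alpha> G \<longleftrightarrow>
     (\<forall>t>0. continuous_on UNIV (\<lambda>x. G x t) \<and> integrable lborel (\<lambda>x. G x t)) \<and>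
     (\<forall>\<kappa>. (\<forall>t>0. ((\<lambda>t. fourier (\<lambda>x. G x t) \<kappa>) has_vector_derivative
                      - of_real (norm \<kappa> powr \<alpha>) * fourier (\<lambda>x. G x t) \<kappa>) (at t)) \<and>
          ((\<lambda>t. fourier (\<lambda>x. G x t) \<kappa>) \<longlongrightarrow> 1) (at_right 0))"
    (is "_ \<longleftrightarrow> ?reg \<and> ?eq")
proof
  assume G: "fundamental_solution \<alpha> G"
  have F: "fourier (\<lambda>x. G x t) \<kappa> = of_real (exp (- (norm \<kappa> powr \<alpha>) * t))" if "t > 0" for t \<kappa>
    using G that by (auto simp: fundamental_solution_def)
  have "((\<lambda>t. fourier (\<lambda>x. G x t) \<kappa>) has_vector_derivative
           - of_real (norm \<kappa> powr \<alpha>) * fourier (\<lambda>x. G x t) \<kappa>) (at t)" if t: "t > 0" for t \<kappa>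
  proof (rule has_vector_derivative_transform_within_open[where S = "{0<..}"])
    show "((\<lambda>t. of_real (exp (- (norm \<kappa> powr \<alpha>) * t))) has_vector_derivative
           - of_real (norm \<kappa> powr \<alpha>) * fourier (\<lambda>x. G x t) \<kappa>) (at t)"
    proof -
      have "((\<lambda>t. exp (- (norm \<kappa> powr \<alpha>) * t)) has_real_derivative
              exp (- (norm \<kappa> powr \<alpha>) * t) * - (norm \<kappa> powr \<alpha>)) (at t)"
        by (rule DERIV_cong, (rule derivative_intros)+) simp
      from has_vector_derivative_of_real[OF this]
      show ?thesis unfolding F[OF t] by (simp add: mult.commute)
    qed
  qed (use t F in auto)
  moreover have "((\<lambda>t. fourier (\<lambda>x. G x t) \<kappa>) \<longlongrightarrow> 1) (at_right 0)" for \<kappa>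
  proof (rule Lim_transform_eventually)
    have "((\<lambda>t. complex_of_real (exp (- (norm \<kappa> powr \<alpha>) * t))) \<longlongrightarrow>
             of_real (exp (- (norm \<kappa> powr \<alpha>) * 0))) (at_right 0)"
      by (intro tendsto_intros)
    then show "((\<lambda>t. complex_of_real (exp (- (norm \<kappa> powr \<alpha>) * t))) \<longlongrightarrow> 1) (at_right 0)"
      by simp
  qed (auto simp: F intro!: eventually_at_rightI[of 0 1])
  ultimately show "?reg \<and> ?eq" using G by (auto simp: fundamental_solution_def)
next
  assume "?reg \<and> ?eq"
  then show "fundamental_solution \<alpha> G"
    unfolding fundamental_solution_def using exp_ode_unique[of "\<lambda>t. fourier (\<lambda>x. G x t) _"] by blast
qed

end

theory Submission
  imports Defs "HOL-Complex_Analysis.Complex_Analysis" "HOL-Probability.Probability"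
    "HOL-Real_Asymp.Real_Asymp"
begin

text \<open>
  Put \<open>\<beta> = \<alpha> / 2\<close>. The kernel \<open>p t s = inverse s * W(- s powr (- \<beta>) * t)\<close>, where \<open>W\<close> is the Wright
  function with parameters \<open>0\<close> and \<open>- \<beta>\<close>, is the density of the one-sided stable subordinator: its
  Laplace transform at \<open>l\<close> is \<open>exp (- t * l powr \<beta>)\<close>. At \<open>l = (norm \<kappa>)\<^sup>2\<close> this says that the symbol
  \<open>exp (- t * norm \<kappa> powr \<alpha>)\<close> is a mixture of the Gaussians \<open>exp (- s * (norm \<kappa>)\<^sup>2)\<close> with weight
  \<open>p t s\<close>. Inverting the Fourier transform turns the Gaussians into heat kernels at time \<open>s\<close>, which is
  the claim. The work lies in the analysis of \<open>p\<close>.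

  The reflection formula for the Gamma function and Euler's integral identify the Wright series with
  the imaginary part of \<open>1 / pi\<close> times the integral of \<open>exp (- s * u - t * u powr \<beta> * cis (- pi * \<beta>))\<close>
  over \<open>u > 0\<close> (\<open>wright_series_eq_integral\<close>, \<open>wright_term\<close>). This form is useless for small \<open>s\<close>, as
  its integrand may grow. Rotating the ray of integration by the angle \<open>\<theta> = pi * \<beta> / (1 + \<beta>)\<close>
  makes both exponentials decay (\<open>rotated_integral\<close>), so \<open>p t\<close> is bounded; the series shows that it is
  \<open>O(s powr (- \<beta> - 1))\<close> at infinity, and so it is integrable.

  By Fubini's theorem the Laplace transform of the rotated integral is the imaginary part of a Cauchy
  type integral along a ray, which is evaluated by a second rotation onto the positive axis after
  removal of the pole (\<open>Im_resolvent_integral\<close>). Both rotations are instances of \<open>ray_rotation\<close>.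

  Inversion is carried out by smoothing with a heat kernel at time \<open>\<epsilon>\<close>: the smoothed \<open>G\<close> equals
  the integral of \<open>p t s * heat_kernel x (s + \<epsilon>)\<close> over \<open>s > 0\<close>
  (\<open>heat_kernel_convolution\<close>, \<open>fourier_inverse_subordinated\<close>), and \<open>\<epsilon>\<close> tends to \<open>0\<close> using the
  continuity of \<open>G\<close> on the left and the boundedness of \<open>s \<mapsto> heat_kernel x s\<close> for \<open>x \<noteq> 0\<close> on the
  right (\<open>subordination_formula\<close>).
\<close>

section \<open>Integrals over the positive half-line\<close>

lemma set_integrable_complex_of_real:
  assumes "set_integrable M A f"
  shows "set_integrable M A (\<lambda>x. complex_of_real (f x))"
proof -
  have "integrable M (\<lambda>x. complex_of_real (indicator A x *\<^sub>R f x))"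
    using assms unfolding set_integrable_def by (rule integrable_of_real)
  then show ?thesis by (simp add: set_integrable_def scaleR_conv_of_real)
qed

text \<open>Young's inequality in disguise: beyond the point where both sides agree with \<open>C = 0\<close> the linear
  term dominates, because \<open>\<beta> < 1\<close>, and before it the power is bounded by its value there.\<close>
lemma powr_le_linear:
  fixes a b \<beta> :: real
  assumes "0 < \<beta>" "\<beta> < 1" "a > 0" "b \<ge> 0"
  shows "\<exists>C. \<forall>u\<ge>0. b * u powr \<beta> \<le> a * u + C"
proof -
  \<comment> \<open>The point where \<open>b * u powr \<beta> = a * u\<close>.\<close>
  define U where "U = (b / a) powr (1 / (1 - \<beta>))"
  have "b * u powr \<beta> \<le> a * u + b * U powr \<beta>" if "u \<ge> 0" for u
  proof (cases "u \<le> U \<or> b = 0")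
    case True
    then show ?thesis using assms that
      by (cases "b = 0") (auto intro!: add_increasing mult_left_mono powr_mono2)
  next
    case False
    then have b: "b > 0" and U: "U > 0" and u: "U < u" using assms by (auto simp: U_def)
    have "u powr \<beta> = u * u powr (\<beta> - 1)"
      using u U by (simp add: powr_diff)
    also have "\<dots> \<le> u * U powr (\<beta> - 1)"
      using u U assms by (intro mult_left_mono powr_mono2') auto
    also have "U powr (\<beta> - 1) = (b / a) powr (- 1)"
    proof -
      have "1 / (1 - \<beta>) * (\<beta> - 1) = - 1" using assms by (simp add: divide_simps)
      then show ?thesis unfolding U_def powr_powr by (rule arg_cong)
    qed
    also have "\<dots> = a / b"
      using assms b by (simp add: powr_minus_divide)
    finally have "b * u powr \<beta> \<le> a * u" using b by (simp add: field_simps)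
    moreover have "0 \<le> b * U powr \<beta>" using b by simp
    ultimately show ?thesis by linarith
  qed
  then show ?thesis by blast
qed

lemma powr_exp_integral:
  fixes a m :: real
  assumes a: "a > -1" and m: "m > 0"
  shows "set_integrable lborel {0<..} (\<lambda>u. u powr a * exp (- (m * u)))"
    and "(LINT u:{0<..}|lborel. u powr a * exp (- (m * u))) = Gamma (a + 1) * m powr (- a - 1)"
proof -
  define f where "f u = indicator {0<..} u *\<^sub>R (u powr a * exp (- u))" for u :: real
  have hi: "((\<lambda>t. t powr a / exp t) has_integral Gamma (a + 1)) {0<..}"
    using Gamma_integral_real[of "a + 1"] a
    by (subst has_integral_closure[symmetric]) auto
  have eq: "t powr a / exp t = t powr a * exp (- t)" for t :: real
    by (simp add: exp_minus field_simps)
  have "(\<lambda>t. t powr a * exp (- t)) absolutely_integrable_on {0<..}"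
    using hi unfolding eq by (intro nonnegative_absolutely_integrable_1) (auto simp: has_integral_iff)
  then have "set_integrable lborel {0<..} (\<lambda>t. t powr a * exp (- t))"
    unfolding set_integrable_def by (subst (asm) integrable_completion) auto
  note si = this
  then have f: "integrable lborel f" by (simp add: set_integrable_def f_def[abs_def])
  have vf: "integral\<^sup>L lborel f = Gamma (a + 1)"
    using set_borel_integral_eq_integral(2)[OF si] hi
    by (simp add: set_lebesgue_integral_def f_def[abs_def] eq has_integral_iff)
  have ff: "f (0 + m * u) = m powr a * (indicator {0<..} u *\<^sub>R (u powr a * exp (- (m * u))))" for u
    using m by (auto simp: f_def indicator_def powr_mult zero_less_mult_iff)
  have "integrable lborel (\<lambda>u. f (0 + m * u))"
    using f m by (subst lborel_integrable_real_affine_iff) auto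
  then have "integrable lborel (\<lambda>u. m powr (- a) * f (0 + m * u))" by simp
  also have "(\<lambda>u. m powr (- a) * f (0 + m * u)) = (\<lambda>u. indicator {0<..} u *\<^sub>R (u powr a * exp (- (m * u))))"
    unfolding ff using m by (auto simp: powr_minus fun_eq_iff)
  finally show "set_integrable lborel {0<..} (\<lambda>u. u powr a * exp (- (m * u)))"
    by (simp add: set_integrable_def)
  have "Gamma (a + 1) = m * (LBINT u. f (0 + m * u))"
    unfolding vf[symmetric] using m by (subst lborel_integral_real_affine[where c = m and t = 0]) auto
  also have "\<dots> = m * m powr a * (LINT u:{0<..}|lborel. u powr a * exp (- (m * u)))"
    unfolding ff set_lebesgue_integral_def by simp
  also have "m * m powr a = m powr (a + 1)" using m by (simp add: powr_add)
  finally show "(LINT u:{0<..}|lborel. u powr a * exp (- (m * u))) = Gamma (a + 1) * m powr (- a - 1)"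
    using m by (simp add: powr_diff powr_minus powr_add field_simps)
qed

lemma set_integrable_exp_neg:
  fixes a :: real
  assumes "a > 0"
  shows "set_integrable lborel {0<..} (\<lambda>u. exp (- (a * u)))"
proof -
  have "set_integrable lborel {0<..} (\<lambda>u. u powr 0 * exp (- (a * u)))"
    using powr_exp_integral(1)[of 0 a] assms by simp
  then show ?thesis
    by (rule set_integrable_cong[THEN iffD1, rotated -1]) auto
qed

lemma set_integrable_exp_linear_powr:
  fixes a b \<beta> :: real
  assumes "0 < \<beta>" "\<beta> < 1" "a > 0" "b \<ge> 0"
  shows "set_integrable lborel {0<..} (\<lambda>u. exp (b * u powr \<beta> - a * u))"
proof -
  obtain C where C: "\<And>u. u \<ge> 0 \<Longrightarrow> b * u powr \<beta> \<le> a / 2 * u + C"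
    using powr_le_linear[of \<beta> "a / 2" b] assms by auto
  have "set_integrable lborel {0<..} (\<lambda>u. exp C * exp (- (a / 2 * u)))"
    using set_integrable_exp_neg[of "a / 2"] assms by (intro set_integrable_mult_right) auto
  then show ?thesis
  proof (rule set_integrable_bound)
    show "AE x in lborel. x \<in> {0<..} \<longrightarrow>
        norm (exp (b * x powr \<beta> - a * x)) \<le> norm (exp C * exp (- (a / 2 * x)))"
      using C by (auto simp flip: exp_add simp: field_simps)
  qed (auto simp: set_borel_measurable_def)
qed

lemma set_integrable_half_line:
  fixes f :: "real \<Rightarrow> 'a :: {banach, second_countable_topology}"
  assumes [measurable]: "f \<in> borel_measurable borel"
    and M: "\<And>u. u > 0 \<Longrightarrow> norm (f u) \<le> M"
    and C: "\<And>u. u \<ge> U \<Longrightarrow> norm (f u) \<le> C * u powr e"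
    and U: "U > 0" and e: "e < -1"
  shows "set_integrable lborel {0<..} f"
proof -
  have "((\<lambda>x. x powr e) has_integral -(U powr (e+1)) / (e+1)) {U..}"
    using e U by (rule has_integral_powr_to_inf)
  then have "(\<lambda>x. x powr e) absolutely_integrable_on {U..}"
    by (intro nonnegative_absolutely_integrable_1) (auto simp: has_integral_iff)
  then have "set_integrable lborel {U..} (\<lambda>x. x powr e)"
    unfolding set_integrable_def by (subst (asm) integrable_completion) auto
  then have "set_integrable lborel {U..} (\<lambda>x. C * x powr e)" by simp
  then have 1: "set_integrable lborel {U..} f"
    by (rule set_integrable_bound) (auto simp: set_borel_measurable_def intro!: always_eventually order_trans[OF C])
  have "set_integrable lborel {0<..<U} (\<lambda>_. M)"
    using U by (simp add: set_integrable_def integrable_indicator_iff)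
  then have 2: "set_integrable lborel {0<..<U} f"
    by (rule set_integrable_bound) (auto simp: set_borel_measurable_def intro!: always_eventually order_trans[OF M])
  have "{0<..<U} \<union> {U..} = {0<..}" using U by auto
  with set_integrable_Un[OF 2 1] show ?thesis by simp
qed

lemma set_integrable_exp_neg_powr:
  fixes c \<beta> :: real
  assumes "c > 0" "\<beta> > 0"
  shows "set_integrable lborel {0<..} (\<lambda>u. exp (- (c * u powr \<beta>)))"
proof -
  have "eventually (\<lambda>u. exp (- (c * u powr \<beta>)) \<le> u powr - 2) at_top"
    using assms by real_asymp
  then obtain U where U: "\<And>u. u \<ge> U \<Longrightarrow> exp (- (c * u powr \<beta>)) \<le> u powr - 2"
    by (auto simp: eventually_at_top_linorder)
  show ?thesis
    by (rule set_integrable_half_line[where M = 1 and C = 1 and U = "max 1 U" and e = "- 2"])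
       (use assms U in auto)
qed

lemma tendsto_integral_half_line:
  fixes f :: "real \<Rightarrow> complex"
  assumes "set_integrable lborel {0<..} f"
  shows "((\<lambda>R. integral {0..R} f) \<longlongrightarrow> (LINT u:{0<..}|lborel. f u)) at_top"
proof -
  \<comment> \<open>The value at \<open>0\<close> is normalised in order to pass to the closed half-line.\<close>
  define f' where "f' u = (if u > 0 then f u else 0)" for u
  have eq: "indicator {0..} u *\<^sub>R f' u = indicator {0<..} u *\<^sub>R f u" for u
    by (auto simp: f'_def indicator_def)
  have si: "set_integrable lborel {0..} f'"
    using assms by (simp add: set_integrable_def eq)
  have "((\<lambda>R. LINT u:{0..R}|lborel. f' u) \<longlongrightarrow> (LINT u:{0..}|lborel. f' u)) at_top"
    by (rule tendsto_set_lebesgue_integral_at_top[OF _ si]) auto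
  moreover have "(LINT u:{0..}|lborel. f' u) = (LINT u:{0<..}|lborel. f u)"
    by (simp add: set_lebesgue_integral_def eq)
  moreover have "(LINT u:{0..R}|lborel. f' u) = integral {0..R} f" for R
  proof -
    have "(LINT u:{0..R}|lborel. f' u) = integral {0..R} f'"
      by (intro set_borel_integral_eq_integral set_integrable_subset[OF si]) auto
    also have "\<dots> = integral {0..R} f"
      by (rule integral_spike[of "{0}"]) (auto simp: f'_def)
    finally show ?thesis .
  qed
  ultimately show ?thesis by simp
qed

lemma exp_half_line_integral:
  fixes w :: complex
  assumes w: "Re w > 0"
  shows "set_integrable lborel {0<..} (\<lambda>s. exp (- of_real s * w))"
    and "(LINT s:{0<..}|lborel. exp (- of_real s * w)) = 1 / w"
proof -
  show si: "set_integrable lborel {0<..} (\<lambda>s. exp (- of_real s * w))"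
    by (rule set_integrable_bound[OF set_integrable_exp_neg[OF w]])
       (auto simp: set_borel_measurable_def norm_exp_eq_Re mult.commute intro!: always_eventually)
  have w0: "w \<noteq> 0" using w by auto
  have "integral {0..R} (\<lambda>s. exp (- of_real s * w)) = (1 - exp (- of_real R * w)) / w" if "R \<ge> 0" for R
  proof -
    have "((\<lambda>s. exp (- of_real s * w)) has_integral ((\<lambda>z. - exp (- z * w) / w) (of_real R) - (\<lambda>z. - exp (- z * w) / w) (of_real 0))) {0..R}"
      using w0 that
      by (intro fundamental_theorem_of_calculus has_vector_derivative_real_field)
         (auto intro!: derivative_eq_intros)
    then show ?thesis by (simp add: has_integral_iff diff_divide_distrib)
  qed
  then have "eventually (\<lambda>R. (1 - exp (- of_real R * w)) / w = integral {0..R} (\<lambda>s. exp (- of_real s * w))) at_top"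
    by (intro eventually_mono[OF eventually_ge_at_top[of 0]]) auto
  moreover have "((\<lambda>R. (1 - exp (- of_real R * w)) / w) \<longlongrightarrow> (1 - 0) / w) at_top"
  proof (intro tendsto_intros)
    have "((\<lambda>R. exp (- (Re w * R))) \<longlongrightarrow> 0) at_top" using w by real_asymp
    then have "((\<lambda>R. norm (exp (- of_real R * w))) \<longlongrightarrow> 0) at_top"
      by (simp add: norm_exp_eq_Re mult.commute)
    then show "((\<lambda>R. exp (- of_real R * w)) \<longlongrightarrow> 0) at_top" by (rule tendsto_norm_zero_cancel)
  qed (use w0 in auto)
  ultimately have "((\<lambda>R. integral {0..R} (\<lambda>s. exp (- of_real s * w))) \<longlongrightarrow> (1 - 0) / w) at_top"
    by (rule Lim_transform_eventually[rotated])
  from tendsto_unique[OF _ tendsto_integral_half_line[OF si] this]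
  show "(LINT s:{0<..}|lborel. exp (- of_real s * w)) = 1 / w" by simp
qed

lemma
  fixes h :: "'a :: euclidean_space \<Rightarrow> 'b :: euclidean_space \<Rightarrow> complex"
  assumes meas: "(\<lambda>(x, y). h x y) \<in> borel_measurable (lborel \<Otimes>\<^sub>M lborel)"
    and f: "integrable lborel f" and g: "integrable lborel g"
    and bound: "\<And>x y. norm (h x y) \<le> f x * g y"
  shows integral_swap_dominated: "(LINT x|lborel. LINT y|lborel. h x y) = (LINT y|lborel. LINT x|lborel. h x y)"
    and integrable_inner_dominated: "integrable lborel (\<lambda>x. LINT y|lborel. h x y)"
proof -
  have f': "integrable lborel (\<lambda>x. \<bar>f x\<bar>)" and g': "integrable lborel (\<lambda>x. \<bar>g x\<bar>)" using f g by auto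
  have [measurable]: "f \<in> borel_measurable borel" "g \<in> borel_measurable borel"
    using f g by (auto simp: integrable_iff_bounded)
  have "integrable (lborel \<Otimes>\<^sub>M lborel) (\<lambda>(x, y). \<bar>f x\<bar> * \<bar>g y\<bar>)"
  proof (rule lborel_pair.Fubini_integrable)
    show "(\<lambda>(x, y). \<bar>f x\<bar> * \<bar>g y\<bar>) \<in> borel_measurable (lborel \<Otimes>\<^sub>M lborel)" by measurable
    show "integrable lborel (\<lambda>x. LINT y|lborel. norm (case (x, y) of (x, y) \<Rightarrow> \<bar>f x\<bar> * \<bar>g y\<bar>))"
      using f' by (simp add: abs_mult)
    show "AE x in lborel. integrable lborel (\<lambda>y. case (x, y) of (x, y) \<Rightarrow> \<bar>f x\<bar> * \<bar>g y\<bar>)"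
      using g' by simp
  qed
  then have hi: "integrable (lborel \<Otimes>\<^sub>M lborel) (\<lambda>(x, y). h x y)"
  proof (rule Bochner_Integration.integrable_bound[OF _ meas])
    have "norm (h x y) \<le> norm (\<bar>f x\<bar> * \<bar>g y\<bar>)" for x y
      using bound[of x y] abs_ge_self[of "f x * g y"] by (simp add: abs_mult)
    then show "AE p in lborel \<Otimes>\<^sub>M lborel. norm (case p of (x, y) \<Rightarrow> h x y) \<le> norm (case p of (x, y) \<Rightarrow> \<bar>f x\<bar> * \<bar>g y\<bar>)"
      by (auto intro!: always_eventually)
  qed
  show "(LINT x|lborel. LINT y|lborel. h x y) = (LINT y|lborel. LINT x|lborel. h x y)"
    using lborel_pair.Fubini_integral[OF hi] by simp
  show "integrable lborel (\<lambda>x. LINT y|lborel. h x y)"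
    using lborel_pair.integrable_fst[OF hi] by simp
qed

section \<open>The Wright series as an oscillatory integral\<close>

text \<open>Expanding \<open>exp (- t * u powr \<beta> * cis (- pi * \<beta>))\<close> and integrating term by term against
  \<open>exp (- s * u)\<close> turns each power of \<open>u\<close> into a value of the Gamma function. The interchange is
  licensed by \<open>exp (t * u powr \<beta> - s * u)\<close>, which is integrable since \<open>\<beta> < 1\<close>. The same majorant
  yields the absolute summability that later controls the density for large \<open>s\<close>.\<close>
lemma wright_series_eq_integral:
  fixes s t \<beta> :: real
  assumes \<beta>: "0 < \<beta>" "\<beta> < 1" and s: "s > 0" and t: "t > 0"
  defines "g \<equiv> \<lambda>u. exp (- of_real (s * u) - of_real (t * u powr \<beta>) * cis (- (pi * \<beta>)))"
  shows "summable (\<lambda>k. t ^ k / fact k * (Gamma (\<beta> * k + 1) * s powr (- (\<beta> * k) - 1)))"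
    and "(\<lambda>k. (- t) ^ k / fact k * (Gamma (\<beta> * k + 1) * s powr (- (\<beta> * k) - 1)) * (- sin (pi * (\<beta> * k)) / pi))
           sums (Im (LINT u:{0<..}|lborel. g u) / pi)"
    and "set_integrable lborel {0<..} g"
proof -
  define c where "c = - of_real t * cis (- (pi * \<beta>))"
  have nc: "norm c = t" using t by (simp add: c_def norm_mult)
  define f where "f k u = indicator {0<..} u *\<^sub>R (c ^ k / fact k * of_real (u powr (\<beta> * k) * exp (- (s * u))))"
    for k :: nat and u :: real
  have fi: "integrable lborel (f k)" for k
  proof -
    have "set_integrable lborel {0<..} (\<lambda>u. u powr (\<beta> * k) * exp (- (s * u)))"
      using \<beta> s by (intro powr_exp_integral) (auto intro: less_le_trans[of _ 0])
    then have "set_integrable lborel {0<..} (\<lambda>u. complex_of_real (u powr (\<beta> * k) * exp (- (s * u))))"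
      by (rule set_integrable_complex_of_real)
    then have "set_integrable lborel {0<..} (\<lambda>u. c ^ k / fact k * complex_of_real (u powr (\<beta> * k) * exp (- (s * u))))"
      by (intro set_integrable_mult_right) auto
    then show ?thesis by (simp add: set_integrable_def f_def[abs_def])
  qed
  have nf: "norm (f k u) = indicator {0<..} u * (t ^ k / fact k * (u powr (\<beta> * k) * exp (- (s * u))))" for k u
    by (simp add: f_def norm_mult norm_divide norm_power nc)
  have vf: "integral\<^sup>L lborel (f k) = c ^ k / fact k * of_real (Gamma (\<beta> * k + 1) * s powr (- (\<beta> * k) - 1))" for k
  proof -
    have "integral\<^sup>L lborel (f k) = (LINT u:{0<..}|lborel. c ^ k / fact k * of_real (u powr (\<beta> * k) * exp (- (s * u))))"
      unfolding f_def[abs_def] set_lebesgue_integral_def ..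
    also have "\<dots> = c ^ k / fact k * of_real (LINT u:{0<..}|lborel. u powr (\<beta> * k) * exp (- (s * u)))"
      by (simp only: set_integral_mult_right set_integral_complex_of_real)
    also have "(LINT u:{0<..}|lborel. u powr (\<beta> * k) * exp (- (s * u))) = Gamma (\<beta> * k + 1) * s powr (- (\<beta> * k) - 1)"
      using \<beta> s by (intro powr_exp_integral) (auto intro: less_le_trans[of _ 0])
    finally show ?thesis .
  qed
  have vnf: "(LINT u|lborel. norm (f k u)) = t ^ k / fact k * (Gamma (\<beta> * k + 1) * s powr (- (\<beta> * k) - 1))" for k
  proof -
    have "(LINT u|lborel. norm (f k u)) = (LINT u:{0<..}|lborel. t ^ k / fact k * (u powr (\<beta> * k) * exp (- (s * u))))"
      unfolding nf set_lebesgue_integral_def real_scaleR_def ..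
    also have "\<dots> = t ^ k / fact k * (LINT u:{0<..}|lborel. u powr (\<beta> * k) * exp (- (s * u)))"
      by (simp only: set_integral_mult_right)
    also have "(LINT u:{0<..}|lborel. u powr (\<beta> * k) * exp (- (s * u))) = Gamma (\<beta> * k + 1) * s powr (- (\<beta> * k) - 1)"
      using \<beta> s by (intro powr_exp_integral) (auto intro: less_le_trans[of _ 0])
    finally show ?thesis .
  qed
  have pk: "u powr (\<beta> * real k) = (u powr \<beta>) ^ k" if "u > 0" for u and k :: nat
    using that by (simp add: powr_realpow[symmetric] powr_powr)
  have nsums: "(\<lambda>k. norm (f k u)) sums (indicator {0<..} u * exp (t * u powr \<beta> - s * u))" for u
  proof (cases "u > 0")
    case True
    have "(\<lambda>k. exp (- (s * u)) * ((t * u powr \<beta>) ^ k /\<^sub>R fact k)) sums (exp (- (s * u)) * exp (t * u powr \<beta>))"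
      by (intro sums_mult exp_converges)
    then show ?thesis using True
      by (simp add: nf pk power_mult_distrib exp_diff exp_minus field_simps)
  qed (simp add: nf)
  have sums: "(\<lambda>k. f k u) sums (indicator {0<..} u *\<^sub>R g u)" for u
  proof (cases "u > 0")
    case True
    have "(\<lambda>k. exp (- of_real (s * u)) * ((c * of_real (u powr \<beta>)) ^ k /\<^sub>R fact k)) sums
       (exp (- of_real (s * u)) * exp (c * of_real (u powr \<beta>)))"
      by (intro sums_mult exp_converges)
    also have "exp (- of_real (s * u)) * exp (c * of_real (u powr \<beta>)) = g u"
      by (simp add: g_def c_def mult_ac exp_add[symmetric])
    also have "(\<lambda>k. exp (- of_real (s * u)) * ((c * of_real (u powr \<beta>)) ^ k /\<^sub>R fact k)) = (\<lambda>k. f k u)"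
      using True by (simp add: fun_eq_iff f_def pk power_mult_distrib scaleR_conv_of_real exp_of_real[symmetric] field_simps)
    finally show ?thesis using True by simp
  qed (simp add: f_def)
  have dom: "integrable lborel (\<lambda>u. indicator {0<..} u * exp (t * u powr \<beta> - s * u))"
    using set_integrable_exp_linear_powr[of \<beta> s t] \<beta> s t by (simp add: set_integrable_def)
  have summ: "summable (\<lambda>k. LINT u|lborel. norm (f k u))"
  proof (rule bounded_imp_summable)
    fix n
    have "(\<Sum>k\<le>n. LINT u|lborel. norm (f k u)) = (LINT u|lborel. (\<Sum>k\<le>n. norm (f k u)))"
      using fi by (subst Bochner_Integration.integral_sum) auto
    also have "\<dots> \<le> (LINT u|lborel. indicator {0<..} u * exp (t * u powr \<beta> - s * u))"
    proof (intro integral_mono dom)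
      fix u
      show "(\<Sum>k\<le>n. norm (f k u)) \<le> indicator {0<..} u * exp (t * u powr \<beta> - s * u)"
        using sum_le_suminf[OF sums_summable[OF nsums[of u]], of "{..n}"] sums_unique[OF nsums[of u]] by simp
    qed (use fi in auto)
    finally show "(\<Sum>k\<le>n. LINT u|lborel. norm (f k u)) \<le> (LINT u|lborel. indicator {0<..} u * exp (t * u powr \<beta> - s * u))" .
  qed auto
  from summ show "summable (\<lambda>k. t ^ k / fact k * (Gamma (\<beta> * k + 1) * s powr (- (\<beta> * k) - 1)))"
    unfolding vnf .
  have ae: "AE u in lborel. summable (\<lambda>k. norm (f k u))"
    using nsums by (auto simp: sums_iff)
  have "(\<lambda>u. \<Sum>k. f k u) = (\<lambda>u. indicator {0<..} u *\<^sub>R g u)"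
    using sums by (auto simp: sums_iff)
  then have gi: "integrable lborel (\<lambda>u. indicator {0<..} u *\<^sub>R g u)"
    and gv: "(\<lambda>k. integral\<^sup>L lborel (f k)) sums (LINT u|lborel. indicator {0<..} u *\<^sub>R g u)"
    using integrable_suminf[OF fi ae summ] sums_integral[OF fi ae summ] by auto
  from gi show "set_integrable lborel {0<..} g" by (simp add: set_integrable_def)
  have "(\<lambda>k. Im (integral\<^sup>L lborel (f k)) / pi) sums (Im (LINT u:{0<..}|lborel. g u) / pi)"
    using gv unfolding set_lebesgue_integral_def by (intro sums_divide sums_Im)
  also have "(\<lambda>k. Im (integral\<^sup>L lborel (f k)) / pi) =
    (\<lambda>k. (- t) ^ k / fact k * (Gamma (\<beta> * k + 1) * s powr (- (\<beta> * k) - 1)) * (- sin (pi * (\<beta> * k)) / pi))"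
  proof
    fix k :: nat
    have ck: "c ^ k = of_real ((- t) ^ k) * cis (- (pi * (\<beta> * k)))"
      unfolding c_def power_mult_distrib Complex.DeMoivre by (simp add: mult_ac)
    have "Im (integral\<^sup>L lborel (f k)) = (- t) ^ k / fact k * (Gamma (\<beta> * k + 1) * s powr (- (\<beta> * k) - 1)) * (- sin (pi * (\<beta> * k)))"
    proof -
      have "integral\<^sup>L lborel (f k) = of_real ((- t) ^ k / fact k * (Gamma (\<beta> * k + 1) * s powr (- (\<beta> * k) - 1))) * cis (- (pi * (\<beta> * k)))"
        unfolding vf ck by (simp add: field_simps)
      moreover have "Im (complex_of_real r * cis y) = r * sin y" for r y by simp
      ultimately show ?thesis by (simp only: sin_minus)
    qed
    then show "Im (integral\<^sup>L lborel (f k)) / pi =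
      (- t) ^ k / fact k * (Gamma (\<beta> * k + 1) * s powr (- (\<beta> * k) - 1)) * (- sin (pi * (\<beta> * k)) / pi)"
      by simp
  qed
  finally show "(\<lambda>k. (- t) ^ k / fact k * (Gamma (\<beta> * k + 1) * s powr (- (\<beta> * k) - 1)) * (- sin (pi * (\<beta> * k)) / pi))
           sums (Im (LINT u:{0<..}|lborel. g u) / pi)" .
qed

text \<open>The reflection formula \<open>rGamma z * rGamma (1 - z) = sin (pi * z) / pi\<close> at \<open>z = - \<beta> * k\<close> moves
  the Gamma function to the numerator, so that it can be represented by Euler's integral; the sine becomes
  the imaginary part of the phase \<open>cis (- pi * \<beta> * k)\<close>.\<close>
lemma wright_term:
  fixes s t \<beta> :: real and k :: nat
  assumes \<beta>: "0 < \<beta>" and s: "s > 0"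
  shows "of_real (inverse s) * ((of_real (- (s powr - \<beta>) * t)) ^ k / fact k * rGamma (0 + of_real (-\<beta>) * of_nat k))
    = complex_of_real ((- t) ^ k / fact k * (Gamma (\<beta> * k + 1) * s powr (- (\<beta> * k) - 1)) * (- sin (pi * (\<beta> * k)) / pi))"
proof -
  have pos: "\<beta> * k + 1 > 0" using \<beta> by (intro add_nonneg_pos) auto
  have "rGamma (of_real (- (\<beta> * k))) * rGamma (1 - of_real (- (\<beta> * k)) :: complex)
      = sin (of_real pi * of_real (- (\<beta> * k))) / of_real pi"
    by (rule rGamma_reflection_complex)
  also have "1 - of_real (- (\<beta> * k)) = complex_of_real (\<beta> * k + 1)" by simp
  also have "rGamma \<dots> = of_real (inverse (Gamma (\<beta> * k + 1)))"
    by (simp only: rGamma_inverse_Gamma Gamma_complex_of_real of_real_inverse)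
  also have "sin (of_real pi * of_real (- (\<beta> * k))) / of_real pi = complex_of_real (- (sin (pi * (\<beta> * k)) / pi))"
    by (simp only: of_real_mult[symmetric] sin_of_real of_real_divide[symmetric]) simp
  finally have "rGamma (complex_of_real (- (\<beta> * k))) =
      complex_of_real (- (sin (pi * (\<beta> * k)) / pi)) * of_real (Gamma (\<beta> * k + 1))"
    using Gamma_real_pos[OF pos] by (simp add: field_simps del: of_real_add)
  then have r: "rGamma (0 + of_real (-\<beta>) * of_nat k) = complex_of_real (- (sin (pi * (\<beta> * k)) / pi * Gamma (\<beta> * k + 1)))"
    by simp
  have *: "of_real (inverse s) * ((of_real (- (s powr - \<beta>) * t)) ^ k / fact k * rGamma (0 + of_real (-\<beta>) * of_nat k))
      = complex_of_real (inverse s * ((- (s powr - \<beta>) * t) ^ k / fact k * (- (sin (pi * (\<beta> * k)) / pi * Gamma (\<beta> * k + 1)))))"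
    unfolding r by simp
  have "(- (s powr - \<beta>) * t) ^ k = (-t) ^ k * s powr (- (\<beta> * k))"
  proof -
    have "(s powr - \<beta>) ^ k = s powr (- (\<beta> * k))"
      using s by (simp add: powr_realpow[symmetric] powr_powr)
    then show ?thesis by (metis (no_types) mult.commute mult_minus_right power_mult_distrib)
  qed
  moreover have "s powr (- (\<beta> * k) - 1) = s powr (- (\<beta> * k)) * inverse s"
    using s by (simp add: powr_diff powr_minus divide_inverse)
  ultimately have "inverse s * ((- (s powr - \<beta>) * t) ^ k / fact k * (- (sin (pi * (\<beta> * k)) / pi * Gamma (\<beta> * k + 1))))
    = (- t) ^ k / fact k * (Gamma (\<beta> * k + 1) * s powr (- (\<beta> * k) - 1)) * (- sin (pi * (\<beta> * k)) / pi)"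
    by (simp add: divide_inverse mult_ac)
  then show ?thesis unfolding * by (rule arg_cong)
qed

section \<open>Rotating a ray of integration\<close>

definition sector :: "complex \<Rightarrow> complex set" where
  "sector e = {of_real a + of_real b * e | a b. a \<ge> 0 \<and> b \<ge> 0}"

text \<open>Cauchy's theorem on the triangle with vertices \<open>0\<close>, \<open>R\<close>, \<open>R * e\<close>. The chord from \<open>R\<close> to
  \<open>R * e\<close> stays at distance proportional to \<open>R\<close> from the origin and has length proportional to
  \<open>R\<close>, so its contribution vanishes as soon as \<open>z * h z\<close> tends to \<open>0\<close>. Using a chord in place of a
  circular arc leaves only straight segments. On the boundary of the sector only
  continuity is asked for, because the integrands below involve \<open>z powr \<beta>\<close>, which is not
  differentiable at the vertex, and a quotient whose removable singularity lies on the positive axis.\<close>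
lemma ray_rotation:
  fixes e :: complex and h :: "complex \<Rightarrow> complex"
  assumes e: "Im e \<noteq> 0"
    and cont: "continuous_on (sector e) h"
    and diff: "\<And>z. z \<in> interior (sector e) \<Longrightarrow> h field_differentiable at z"
    and decay: "\<And>z. z \<in> sector e \<Longrightarrow> norm z \<ge> B\<^sub>0 \<Longrightarrow> norm z * norm (h z) \<le> g (norm z)"
    and g: "(g \<longlongrightarrow> 0) at_top"
  shows "((\<lambda>R. integral {0..R} (\<lambda>u. h (of_real u)) - e * integral {0..R} (\<lambda>u. h (of_real u * e))) \<longlongrightarrow> 0) at_top"
proof (rule tendstoI)
  fix \<epsilon> :: real assume \<epsilon>: "\<epsilon> > 0"
  \<comment> \<open>For \<open>R > 0\<close> the chord from \<open>R\<close> to \<open>R * e\<close> has distance \<open>R * D\<close> from the origin.\<close>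
  define D where "D = infdist 0 (closed_segment 1 e)"
  have D: "D > 0"
  proof -
    have "0 \<notin> closed_segment 1 e"
    proof
      assume "0 \<in> closed_segment 1 e"
      then obtain u where u: "0 = (1 - u) *\<^sub>R 1 + u *\<^sub>R e" by (auto simp: closed_segment_def)
      have "Im (0::complex) = u * Im e" "Re (0::complex) = (1 - u) + u * Re e"
        by (subst u, simp)+
      then show False using e by auto
    qed
    then show ?thesis unfolding D_def
      by (simp add: infdist_pos_not_in_closed)
  qed
  have Dle: "D \<le> norm z" if "z \<in> closed_segment 1 e" for z
    using infdist_le[OF that, of 0] by (simp add: D_def)
  have "e \<noteq> 1" using e by auto
  define \<epsilon>' where "\<epsilon>' = \<epsilon> * D / (2 * norm (e - 1))"
  have \<epsilon>': "\<epsilon>' > 0" using \<epsilon> D \<open>e \<noteq> 1\<close> by (simp add: \<epsilon>'_def)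
  obtain B where B: "\<And>z. z \<in> sector e \<Longrightarrow> norm z \<ge> B \<Longrightarrow> norm z * norm (h z) \<le> \<epsilon>'"
  proof -
    have "eventually (\<lambda>x. g x < \<epsilon>' \<and> x \<ge> B\<^sub>0) at_top"
      by (intro eventually_conj order_tendstoD(2)[OF g \<epsilon>'] eventually_ge_at_top)
    then obtain B where "\<And>x. x \<ge> B \<Longrightarrow> g x < \<epsilon>' \<and> x \<ge> B\<^sub>0"
      by (auto simp: eventually_at_top_linorder)
    then have "norm z * norm (h z) \<le> \<epsilon>'" if "z \<in> sector e" "norm z \<ge> B" for z
      using decay[of z] that by force
    then show ?thesis by (rule that)
  qed
  have "norm (integral {0..R} (\<lambda>u. h (of_real u)) - e * integral {0..R} (\<lambda>u. h (of_real u * e))) < \<epsilon>"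
    if R: "R > 0" "R * D \<ge> B" for R
  proof -
    have hull: "convex hull {0, of_real R, of_real R * e} \<subseteq> sector e"
    proof
      fix z assume "z \<in> convex hull {0, of_real R, of_real R * e}"
      then obtain u v w where "u \<ge> 0" "v \<ge> 0" "w \<ge> 0" "z = u *\<^sub>R 0 + v *\<^sub>R of_real R + w *\<^sub>R (of_real R * e)"
        unfolding convex_hull_3 by auto
      then have "z = of_real (v * R) + of_real (w * R) * e" "v * R \<ge> 0" "w * R \<ge> 0"
        using R by (auto simp: scaleR_conv_of_real mult_ac)
      then show "z \<in> sector e" unfolding sector_def by blast
    qed
    have "(h has_contour_integral 0) (linepath 0 (of_real R) +++ linepath (of_real R) (of_real R * e) +++ linepath (of_real R * e) 0)"
    proof (rule Cauchy_theorem_triangle_cofinite[where S = "{}"])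
      show "continuous_on (convex hull {0, of_real R, of_real R * e}) h"
        using cont hull by (rule continuous_on_subset)
      fix z assume "z \<in> interior (convex hull {0, of_real R, of_real R * e}) - {}"
      then show "h field_differentiable at z"
        using interior_mono[OF hull] by (intro diff) auto
    qed auto
    note chain = has_chain_integral_chain_integral3[OF this]
    have segS: "closed_segment a b \<subseteq> sector e" if "a \<in> {0, of_real R, of_real R * e}" "b \<in> {0, of_real R, of_real R * e}" for a b
      using that hull by (meson closed_segment_subset convex_convex_hull hull_inc order_trans)
    have ci: "h contour_integrable_on linepath a b" if "a \<in> {0, of_real R, of_real R * e}" "b \<in> {0, of_real R, of_real R * e}" for a b
      by (intro contour_integrable_continuous_linepath continuous_on_subset[OF cont] segS that)
    have chord: "norm (contour_integral (linepath (of_real R) (of_real R * e)) h) \<le> \<epsilon>' / (R * D) * norm (of_real R * e - of_real R)"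
    proof (rule contour_integral_bound_linepath)
      fix z assume z: "z \<in> closed_segment (of_real R) (of_real R * e)"
      then obtain u where "0 \<le> u" "u \<le> 1" and zu: "z = (1 - u) *\<^sub>R of_real R + u *\<^sub>R (of_real R * e)"
        by (auto simp: closed_segment_def)
      define w where "w = (1 - u) *\<^sub>R 1 + u *\<^sub>R e"
      have "w \<in> closed_segment 1 e" using \<open>0 \<le> u\<close> \<open>u \<le> 1\<close> by (auto simp: closed_segment_def w_def)
      then have "D \<le> norm w" by (rule Dle)
      moreover have "z = of_real R * w" unfolding zu w_def by (simp add: scaleR_conv_of_real algebra_simps)
      ultimately have zD: "R * D \<le> norm z" using R by (simp add: norm_mult)
      have "z \<in> sector e" using z segS by blast
      then have "norm z * norm (h z) \<le> \<epsilon>'" using R zD by (intro B) auto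
      then have "R * D * norm (h z) \<le> \<epsilon>'"
        by (meson zD dual_order.trans mult_right_mono norm_ge_zero)
      then show "norm (h z) \<le> \<epsilon>' / (R * D)" using R D by (simp add: field_simps)
    qed (use ci \<epsilon>' R D in auto)
    have one: "contour_integral (linepath 0 (of_real R)) h = integral {0..R} (\<lambda>u. h (of_real u))"
      using R by (subst contour_integral_linepath_Reals_eq) auto
    have two: "contour_integral (linepath 0 (of_real R * e)) h = e * integral {0..R} (\<lambda>u. h (of_real u * e))"
    proof -
      have "(h has_contour_integral contour_integral (linepath 0 (of_real R * e)) h) (linepath 0 (of_real R * e))"
        using ci by (simp add: has_contour_integral_integral)
      then have "((\<lambda>x. h (linepath 0 (of_real R * e) x) * (of_real R * e)) has_integral contour_integral (linepath 0 (of_real R * e)) h) {0..1}"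
        by (simp add: has_contour_integral_linepath)
      moreover have img: "(\<lambda>x. x * R) ` {0..1} = {0..R}"
        using image_mult_atLeastAtMost[of R 0 1] R by (simp add: mult.commute)
      ultimately have "((\<lambda>x. (of_real R * e) * h (of_real (R * x) * e)) has_integral contour_integral (linepath 0 (of_real R * e)) h) {0..1}"
        by (simp add: linepath_def scaleR_conv_of_real mult_ac)
      then have "((\<lambda>x. (of_real R * e) * h (of_real (R * (x / R)) * e)) has_integral (R *\<^sub>R contour_integral (linepath 0 (of_real R * e)) h)) {0..R}"
        using has_integral_stretch_real[of "\<lambda>x. (of_real R * e) * h (of_real (R * x) * e)" _ 0 1 "1 / R"] R img
        by auto
      then have "((\<lambda>x. inverse (of_real R) * ((of_real R * e) * h (of_real (R * (x / R)) * e))) has_integral (inverse (of_real R) * (R *\<^sub>R contour_integral (linepath 0 (of_real R * e)) h))) {0..R}"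
        by (rule has_integral_mult_right)
      then have "((\<lambda>x. e * h (of_real x * e)) has_integral (contour_integral (linepath 0 (of_real R * e)) h)) {0..R}"
        using R by (simp add: scaleR_conv_of_real field_simps)
      then show ?thesis by (simp add: has_integral_iff)
    qed
    have "integral {0..R} (\<lambda>u. h (of_real u)) - e * integral {0..R} (\<lambda>u. h (of_real u * e)) =
       - contour_integral (linepath (of_real R) (of_real R * e)) h"
    proof -
      have rev: "contour_integral (linepath 0 (of_real R * e)) h = - contour_integral (linepath (of_real R * e) 0) h"
        by (intro contour_integral_reverse_linepath continuous_on_subset[OF cont] segS) auto
      have "b - p = - c" if "a + (b + c) = 0" "p = - a" for a b c p :: complex
        using that by (metis add.commute add.left_commute diff_minus_eq_add eq_neg_iff_add_eq_0)
      moreover have "contour_integral (linepath (of_real R * e) 0) h + (contour_integral (linepath 0 (of_real R)) h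
          + contour_integral (linepath (of_real R) (of_real R * e)) h) = 0"
        using chain by (simp only: add_ac)
      ultimately show ?thesis
        unfolding one[symmetric] two[symmetric] using rev by blast
    qed
    then have "norm (integral {0..R} (\<lambda>u. h (of_real u)) - e * integral {0..R} (\<lambda>u. h (of_real u * e))) 
        \<le> \<epsilon>' / (R * D) * norm (of_real R * e - of_real R)" using chord by simp
    also have "norm (of_real R * e - of_real R) = R * norm (e - 1)"
    proof -
      have "of_real R * e - of_real R = of_real R * (e - 1)" by (simp add: algebra_simps)
      then show ?thesis using R by (simp only: norm_mult norm_of_real)
    qed
    also have "\<epsilon>' / (R * D) * (R * norm (e - 1)) = \<epsilon> / 2"
      using R D \<open>e \<noteq> 1\<close> by (simp add: \<epsilon>'_def)
    also have "\<dots> < \<epsilon>" using \<epsilon> by simp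
    finally show ?thesis .
  qed
  moreover have "eventually (\<lambda>R. R > 0 \<and> R * D \<ge> B) at_top"
    using eventually_gt_at_top[of 0] eventually_ge_at_top[of "B / D"]
    by eventually_elim (use D in \<open>auto simp: field_simps\<close>)
  ultimately show "eventually (\<lambda>R. dist (integral {0..R} (\<lambda>u. h (of_real u)) - e * integral {0..R} (\<lambda>u. h (of_real u * e))) 0 < \<epsilon>) at_top"
    by (auto elim: eventually_mono simp: dist_norm)
qed

lemma of_real_cis_powr:
  assumes "u \<ge> 0" "- pi < \<eta>" "\<eta> \<le> pi"
  shows "(of_real u * cis \<eta>) powr of_real b = of_real (u powr b) * cis (b * \<eta>)"
proof (cases "u = 0")
  case False
  then have u: "u > 0" using assms by simp
  have "Ln (of_real u * cis \<eta>) = of_real (ln u) + \<i> * of_real \<eta>"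
  proof -
    have "Ln (cis \<eta>) = \<i> * of_real \<eta>"
      unfolding cis_conv_exp using assms by (intro Ln_exp) auto
    then show ?thesis using u by (subst Ln_times_of_real) (auto simp: Ln_of_real)
  qed
  then show ?thesis using u
    by (simp add: powr_def cis_conv_exp exp_of_real[symmetric] exp_add[symmetric] algebra_simps)
qed simp

lemma Re_sector_ge:
  assumes "z \<in> sector (cis \<theta>)" 
  shows "Re z \<ge> cos \<theta> * norm z"
proof -
  obtain a b where z: "z = of_real a + of_real b * cis \<theta>" "a \<ge> 0" "b \<ge> 0"
    using assms by (auto simp: sector_def)
  have n: "norm z \<le> a + b"
    unfolding z(1) using z norm_triangle_ineq[of "of_real a" "of_real b * cis \<theta>"] by (simp add: norm_mult)
  have "cos \<theta> * norm z \<le> a + b * cos \<theta>"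
  proof (cases "cos \<theta> \<ge> 0")
    case True
    have "cos \<theta> * norm z \<le> cos \<theta> * (a + b)" using n True by (rule mult_left_mono)
    also have "\<dots> \<le> a + b * cos \<theta>" using z mult_right_mono[OF cos_le_one[of \<theta>], of a] by (simp add: algebra_simps)
    finally show ?thesis .
  next
    case False
    have "b - a \<le> norm z"
      unfolding z(1) using z norm_diff_ineq[of "of_real b * cis \<theta>" "of_real a"] by (simp add: norm_mult add.commute)
    then have "cos \<theta> * norm z \<le> cos \<theta> * (b - a)" using False by (intro mult_left_mono_neg) auto
    also have "\<dots> = b * cos \<theta> + a * (- cos \<theta>)" by (simp add: algebra_simps)
    also have "\<dots> \<le> b * cos \<theta> + a * 1" using z cos_ge_minus_one[of \<theta>] by (intro add_left_mono mult_left_mono) auto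
    finally show ?thesis by simp
  qed
  then show ?thesis by (simp add: z(1))
qed

lemma lower_sector_arg:
  assumes z: "z \<in> sector (cis (- \<psi>))" and \<psi>: "0 < \<psi>" "\<psi> < pi"
  shows "Im z \<le> 0" and "z \<noteq> 0 \<Longrightarrow> z \<notin> \<real>\<^sub>\<le>\<^sub>0" and "z \<noteq> 0 \<Longrightarrow> Arg z \<in> {- \<psi>..0}"
proof -
  obtain a b where ab: "z = of_real a + of_real b * cis (- \<psi>)" "a \<ge> 0" "b \<ge> 0"
    using z by (auto simp: sector_def)
  have s: "sin \<psi> > 0" using \<psi> by (intro sin_gt_zero) auto
  show Im: "Im z \<le> 0" using ab s by simp
  show "z \<notin> \<real>\<^sub>\<le>\<^sub>0" if "z \<noteq> 0"
    using that ab s by (auto simp: complex_nonpos_Reals_iff complex_eq_iff)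
  assume z0: "z \<noteq> 0"
  define \<eta> where "\<eta> = Arg z"
  have \<eta>: "- pi < \<eta>" "\<eta> \<le> pi" by (auto simp: \<eta>_def mpi_less_Arg Arg_le_pi)
  have zr: "z = of_real (norm z) * cis \<eta>"
    using rcis_cmod_Arg[of z] by (simp add: rcis_def \<eta>_def)
  have n: "norm z > 0" using z0 by simp
  have 1: "sin \<eta> \<le> 0"
  proof -
    have "Im z = norm z * sin \<eta>" by (subst zr) simp
    then show ?thesis using Im n by (simp add: mult_le_0_iff)
  qed
  have 2: "sin (\<eta> + \<psi>) \<ge> 0"
  proof -
    have "z * cis \<psi> = of_real (norm z) * cis (\<eta> + \<psi>)" by (subst zr) (simp add: cis_mult mult.assoc)
    then have "Im (z * cis \<psi>) = norm z * sin (\<eta> + \<psi>)" by simp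
    moreover have "Im (z * cis \<psi>) = a * sin \<psi>"
      unfolding ab(1) by (simp add: distrib_right mult.assoc cis_mult)
    ultimately have "norm z * sin (\<eta> + \<psi>) \<ge> 0" using ab s by simp
    then show ?thesis using n by (simp add: zero_le_mult_iff)
  qed
  have "\<eta> \<le> 0"
  proof (rule ccontr)
    assume "\<not> \<eta> \<le> 0"
    then have "\<eta> = pi" using 1 \<eta> sin_gt_zero[of \<eta>] by (cases "\<eta> = pi") auto
    then show False using 2 s by simp
  qed
  moreover have "\<eta> \<ge> - \<psi>"
  proof (rule ccontr)
    assume "\<not> \<eta> \<ge> - \<psi>"
    then have "sin (- (\<eta> + \<psi>)) > 0" using \<eta> \<psi> by (intro sin_gt_zero) auto
    then show False using 2 unfolding sin_minus by simp
  qed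
  ultimately show "Arg z \<in> {- \<psi>..0}" by (simp add: \<eta>_def)
qed

text \<open>On the sector between the positive axis and the ray of angle \<open>- \<psi>\<close> the argument of \<open>z powr \<beta>\<close>
  lies in \<open>{- \<beta> * \<psi>..0}\<close>, so \<open>exp (- t * z powr \<beta>)\<close> decays there as long as
  \<open>\<beta> * \<psi> < pi / 2\<close>, even when the sector reaches into the left half-plane.\<close>
lemma Re_powr_sector:
  assumes z: "z \<in> sector (cis (- \<psi>))" and \<psi>: "0 < \<psi>" "\<psi> < pi" and \<beta>: "0 < \<beta>" "\<beta> < 1"
  shows "Re (z powr of_real \<beta>) \<ge> norm z powr \<beta> * cos (\<beta> * \<psi>)"
proof (cases "z = 0")
  case False
  have "z powr of_real \<beta> = (of_real (norm z) * cis (Arg z)) powr of_real \<beta>"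
    using rcis_cmod_Arg[of z] by (simp add: rcis_def)
  also have "\<dots> = of_real (norm z powr \<beta>) * cis (\<beta> * Arg z)"
    by (rule of_real_cis_powr) (auto simp: mpi_less_Arg Arg_le_pi)
  finally have "Re (z powr of_real \<beta>) = norm z powr \<beta> * cos (\<beta> * (- Arg z))" by simp
  moreover have "cos (\<beta> * (- Arg z)) \<ge> cos (\<beta> * \<psi>)"
  proof -
    have A: "- Arg z \<ge> 0" "- Arg z \<le> \<psi>" using lower_sector_arg(3)[OF z \<psi> False] by auto
    have "\<beta> * (- Arg z) \<le> \<beta> * \<psi>" using A \<beta> by (intro mult_left_mono) auto
    moreover have "\<beta> * \<psi> \<le> 1 * pi" using \<beta> \<psi> by (intro mult_mono) auto
    moreover have "\<beta> * (- Arg z) \<ge> 0" using A \<beta> by (intro mult_nonneg_nonneg) auto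
    ultimately show ?thesis by (intro cos_monotone_0_pi_le) auto
  qed
  ultimately show ?thesis by (simp add: mult_left_mono)
qed auto

section \<open>The subordinator density\<close>

text \<open>The angle \<open>\<theta>\<close> solving \<open>\<beta> * (pi - \<theta>) = \<theta>\<close>. For it the two phases that appear after rotation,
  that of \<open>s * u\<close> and that of \<open>t * u powr \<beta>\<close>, are \<open>\<theta>\<close> and \<open>- \<theta>\<close>, hence both exponentials decay
  at once.\<close>
definition rotation_angle :: "real \<Rightarrow> real" where
  "rotation_angle \<beta> = pi * \<beta> / (1 + \<beta>)"

lemma rotation_angle:
  assumes "0 < \<beta>" "\<beta> < 1"
  shows "0 < rotation_angle \<beta>" "rotation_angle \<beta> < pi / 2" "\<beta> * (pi - rotation_angle \<beta>) = rotation_angle \<beta>"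
    "cos (rotation_angle \<beta>) > 0" "sin (rotation_angle \<beta>) > 0"
proof -
  show 1: "0 < rotation_angle \<beta>" using assms by (simp add: rotation_angle_def)
  show 2: "rotation_angle \<beta> < pi / 2" using assms by (simp add: rotation_angle_def field_simps)
  show "\<beta> * (pi - rotation_angle \<beta>) = rotation_angle \<beta>" using assms by (simp add: rotation_angle_def field_simps)
  show "cos (rotation_angle \<beta>) > 0" "sin (rotation_angle \<beta>) > 0"
    using 1 2 by (auto intro!: cos_gt_zero_pi sin_gt_zero)
qed

definition rotated_kernel :: "real \<Rightarrow> real \<Rightarrow> real \<Rightarrow> real \<Rightarrow> complex" where
  "rotated_kernel \<beta> t s u = exp (- of_real (s * u) * cis (rotation_angle \<beta>) - of_real (t * u powr \<beta>) * cis (- rotation_angle \<beta>))"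

lemma norm_rotated_kernel:
  "norm (rotated_kernel \<beta> t s u) = exp (- (s * cos (rotation_angle \<beta>) * u) - t * cos (rotation_angle \<beta>) * u powr \<beta>)"
  by (simp add: rotated_kernel_def norm_exp_eq_Re mult_ac)

lemma rotated_kernel_measurable [measurable]:
  "(\<lambda>(s, u). rotated_kernel \<beta> t s u) \<in> borel_measurable (lborel \<Otimes>\<^sub>M lborel)"
  "rotated_kernel \<beta> t s \<in> borel_measurable borel"
  unfolding rotated_kernel_def[abs_def] by measurable

lemma set_integrable_rotated_kernel:
  assumes "0 < \<beta>" "\<beta> < 1" "s > 0" "t > 0"
  shows "set_integrable lborel {0<..} (rotated_kernel \<beta> t s)"
proof (rule set_integrable_bound[OF set_integrable_exp_neg[of "s * cos (rotation_angle \<beta>)"]])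
  show "AE u in lborel. u \<in> {0<..} \<longrightarrow> norm (rotated_kernel \<beta> t s u) \<le> norm (exp (- (s * cos (rotation_angle \<beta>) * u)))"
    using assms rotation_angle[of \<beta>] by (auto simp: norm_rotated_kernel intro!: always_eventually)
qed (use assms rotation_angle[of \<beta>] in \<open>auto simp: set_borel_measurable_def\<close>)

text \<open>The density of the one-sided stable law of index \<open>\<beta>\<close> at time \<open>t\<close>, written as the integral that
  is absolutely convergent uniformly in \<open>s\<close>.\<close>
definition subordinator_density :: "real \<Rightarrow> real \<Rightarrow> real \<Rightarrow> real" where
  "subordinator_density \<beta> t s = Im (cis (rotation_angle \<beta>) * (LINT u:{0<..}|lborel. rotated_kernel \<beta> t s u)) / pi"

lemma subordinator_density_measurable [measurable]:
  "subordinator_density \<beta> t \<in> borel_measurable borel"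
proof -
  have "(\<lambda>s. LINT u|lborel. indicator {0<..} u *\<^sub>R rotated_kernel \<beta> t s u) \<in> borel_measurable lborel"
    by (rule lborel.borel_measurable_lebesgue_integral) measurable
  then show ?thesis
    unfolding subordinator_density_def[abs_def] set_lebesgue_integral_def by simp
qed

text \<open>In the unrotated integral the factor \<open>exp (- t * u powr \<beta> * cis (- pi * \<beta>))\<close> grows for
  \<open>\<beta> > 1/2\<close>, and the bound it gives blows up as \<open>s\<close> tends to \<open>0\<close> faster than the heat kernel can
  compensate. Rotation by \<open>rotation_angle \<beta>\<close> removes the growth.\<close>
lemma rotated_integral:
  fixes s t \<beta> :: real
  assumes \<beta>: "0 < \<beta>" "\<beta> < 1" and s: "s > 0" and t: "t > 0"
  shows "(LINT u:{0<..}|lborel. exp (- of_real (s * u) - of_real (t * u powr \<beta>) * cis (- (pi * \<beta>))))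
    = cis (rotation_angle \<beta>) * (LINT u:{0<..}|lborel. rotated_kernel \<beta> t s u)"
proof -
  define \<theta> where "\<theta> = rotation_angle \<beta>"
  note \<theta> = rotation_angle[OF \<beta>, folded \<theta>_def]
  define h where "h z = exp (- of_real s * z - of_real t * (z powr of_real \<beta>) * cis (- (pi * \<beta>)))" for z
  have Re: "Re z \<ge> 0" if "z \<in> sector (cis \<theta>)" for z
    using Re_sector_ge[OF that] \<theta> by (meson dual_order.trans less_imp_le mult_nonneg_nonneg norm_ge_zero)
  obtain C where C: "\<And>u. u \<ge> 0 \<Longrightarrow> t * u powr \<beta> \<le> s * cos \<theta> / 2 * u + C"
    using powr_le_linear[of \<beta> "s * cos \<theta> / 2" t] \<beta> s t \<theta> by auto
  define a where "a = s * cos \<theta> / 2"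
  have a: "a > 0" using s \<theta> by (simp add: a_def)
  have "((\<lambda>R. integral {0..R} (\<lambda>u. h (of_real u)) - cis \<theta> * integral {0..R} (\<lambda>u. h (of_real u * cis \<theta>))) \<longlongrightarrow> 0) at_top"
  proof (rule ray_rotation[where g = "\<lambda>x. x * exp (C - a * x)" and B\<^sub>0 = 0])
    show "continuous_on (sector (cis \<theta>)) h"
      unfolding h_def using Re \<beta> by (intro continuous_intros) auto
    show "h field_differentiable at z" if "z \<in> interior (sector (cis \<theta>))" for z
    proof -
      have "z \<in> interior {z. Re z \<ge> 0}"
        using that interior_mono[of "sector (cis \<theta>)" "{z. Re z \<ge> 0}"] Re by auto
      then have "Re z > 0" 
        using interior_halfspace_ge[of "1::complex" 0] by simp
      then have "z \<notin> \<real>\<^sub>\<le>\<^sub>0" by (auto simp: complex_nonpos_Reals_iff)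
      moreover have "h holomorphic_on - \<real>\<^sub>\<le>\<^sub>0"
        unfolding h_def by (intro holomorphic_intros) auto
      ultimately show ?thesis
        by (intro holomorphic_on_imp_differentiable_at[of h "- \<real>\<^sub>\<le>\<^sub>0"]) auto
    qed
    show "norm z * norm (h z) \<le> norm z * exp (C - a * norm z)" if "z \<in> sector (cis \<theta>)" for z
    proof (rule mult_left_mono)
      have "norm (h z) = exp (Re (- of_real s * z - of_real t * (z powr of_real \<beta>) * cis (- (pi * \<beta>))))"
        by (simp add: h_def norm_exp_eq_Re)
      also have "\<dots> \<le> exp (C - a * norm z)"
      proof -
        have "Re (- (of_real t * (z powr of_real \<beta>) * cis (- (pi * \<beta>)))) \<le> norm (- (of_real t * (z powr of_real \<beta>) * cis (- (pi * \<beta>))))"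
          by (rule complex_Re_le_cmod)
        also have "\<dots> = t * norm z powr \<beta>" using t by (simp add: norm_mult norm_powr_real_powr')
        also have "\<dots> \<le> a * norm z + C" using C[of "norm z"] by (simp add: a_def)
        finally have 1: "Re (- (of_real t * (z powr of_real \<beta>) * cis (- (pi * \<beta>)))) \<le> a * norm z + C" .
        have "s * (cos \<theta> * norm z) \<le> s * Re z" using Re_sector_ge[OF that] s by (intro mult_left_mono) auto
        then have 2: "Re (- of_real s * z) \<le> - 2 * a * norm z" by (simp add: a_def)
        have "Re (- of_real s * z - of_real t * (z powr of_real \<beta>) * cis (- (pi * \<beta>))) =
            Re (- of_real s * z) + Re (- (of_real t * (z powr of_real \<beta>) * cis (- (pi * \<beta>))))"
          by simp
        with 1 2 show ?thesis by simp
      qed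
      finally show "norm (h z) \<le> exp (C - a * norm z)" .
    qed auto
    show "((\<lambda>x. x * exp (C - a * x)) \<longlongrightarrow> 0) at_top" using a by real_asymp
  qed (use \<theta> in auto)
  also have "(\<lambda>R. integral {0..R} (\<lambda>u. h (of_real u)) - cis \<theta> * integral {0..R} (\<lambda>u. h (of_real u * cis \<theta>)))
    = (\<lambda>R. integral {0..R} (\<lambda>u. exp (- of_real (s * u) - of_real (t * u powr \<beta>) * cis (- (pi * \<beta>)))) - 
        cis \<theta> * integral {0..R} (rotated_kernel \<beta> t s))"
  proof
    fix R
    have 1: "h (of_real u) = exp (- of_real (s * u) - of_real (t * u powr \<beta>) * cis (- (pi * \<beta>)))" if "u \<ge> 0" for u
      using that by (simp add: h_def powr_of_real)
    have 2: "h (of_real u * cis \<theta>) = rotated_kernel \<beta> t s u" if "u \<ge> 0" for u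
    proof -
      have "(of_real u * cis \<theta>) powr of_real \<beta> * cis (- (pi * \<beta>)) = of_real (u powr \<beta>) * cis (\<beta> * \<theta> - pi * \<beta>)"
        using that \<theta> by (subst of_real_cis_powr) (auto simp: cis_mult)
      also have "\<beta> * \<theta> - pi * \<beta> = - \<theta>" using \<theta>(3) by (simp add: algebra_simps)
      finally show ?thesis by (simp add: h_def rotated_kernel_def \<theta>_def mult_ac)
    qed
    show "integral {0..R} (\<lambda>u. h (of_real u)) - cis \<theta> * integral {0..R} (\<lambda>u. h (of_real u * cis \<theta>)) =
      integral {0..R} (\<lambda>u. exp (- of_real (s * u) - of_real (t * u powr \<beta>) * cis (- (pi * \<beta>)))) - 
        cis \<theta> * integral {0..R} (rotated_kernel \<beta> t s)"
      using 1 2 by (intro arg_cong2[where f = "\<lambda>x y. x - cis \<theta> * y"] integral_cong) auto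
  qed
  finally have *: "((\<lambda>R. integral {0..R} (\<lambda>u. exp (- of_real (s * u) - of_real (t * u powr \<beta>) * cis (- (pi * \<beta>)))) - 
        cis \<theta> * integral {0..R} (rotated_kernel \<beta> t s)) \<longlongrightarrow> 0) at_top" .
  have "((\<lambda>R. integral {0..R} (\<lambda>u. exp (- of_real (s * u) - of_real (t * u powr \<beta>) * cis (- (pi * \<beta>)))) - 
        cis \<theta> * integral {0..R} (rotated_kernel \<beta> t s)) \<longlongrightarrow>
    (LINT u:{0<..}|lborel. exp (- of_real (s * u) - of_real (t * u powr \<beta>) * cis (- (pi * \<beta>))))
    - cis \<theta> * (LINT u:{0<..}|lborel. rotated_kernel \<beta> t s u)) at_top"
    by (intro tendsto_intros tendsto_integral_half_line wright_series_eq_integral(3) set_integrable_rotated_kernel assms)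
  from tendsto_unique[OF _ * this] show ?thesis by (simp add: \<theta>_def)
qed

lemma subordinator_density_sums:
  fixes s t \<beta> :: real
  assumes \<beta>: "0 < \<beta>" "\<beta> < 1" and s: "s > 0" and t: "t > 0"
  shows "(\<lambda>k. (- t) ^ k / fact k * (Gamma (\<beta> * k + 1) * s powr (- (\<beta> * k) - 1)) * (- sin (pi * (\<beta> * k)) / pi))
           sums subordinator_density \<beta> t s"
  using wright_series_eq_integral(2)[OF assms] unfolding rotated_integral[OF assms] subordinator_density_def .

lemma Wright_eq_subordinator_density:
  fixes s t \<beta> :: real
  assumes \<beta>: "0 < \<beta>" "\<beta> < 1" and s: "s > 0" and t: "t > 0"
  shows "of_real (inverse s) * Wright 0 (- \<beta>) (of_real (- (s powr - \<beta>) * t)) = of_real (subordinator_density \<beta> t s)"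
proof -
  have "(\<lambda>k. complex_of_real (inverse s) * ((of_real (- (s powr - \<beta>) * t)) ^ k / fact k * rGamma (0 + of_real (-\<beta>) * of_nat k)))
      sums of_real (subordinator_density \<beta> t s)"
    unfolding wright_term[OF \<beta>(1) s] sums_of_real_iff by (rule subordinator_density_sums[OF assms])
  then have "of_real s * of_real (subordinator_density \<beta> t s) = Wright 0 (- \<beta>) (of_real (- (s powr - \<beta>) * t))"
    unfolding Wright_def
    by (drule_tac sums_mult[where c = "of_real s"]) (use s in \<open>simp add: sums_iff mult.assoc[symmetric]\<close>)
  then show ?thesis using s by (simp add: field_simps)
qed

lemma subordinator_density_bounded:
  fixes t \<beta> :: real
  assumes \<beta>: "0 < \<beta>" "\<beta> < 1" and t: "t > 0"
  shows "\<exists>M. \<forall>s>0. \<bar>subordinator_density \<beta> t s\<bar> \<le> M"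
proof (intro exI allI impI)
  fix s :: real assume s: "s > 0"
  define c where "c = t * cos (rotation_angle \<beta>)"
  have c: "c > 0" using rotation_angle[OF \<beta>] t by (simp add: c_def)
  have "\<bar>subordinator_density \<beta> t s\<bar> \<le> norm (LINT u:{0<..}|lborel. rotated_kernel \<beta> t s u) / pi"
    using abs_Im_le_cmod[of "cis (rotation_angle \<beta>) * (LINT u:{0<..}|lborel. rotated_kernel \<beta> t s u)"]
    by (simp add: subordinator_density_def norm_mult divide_right_mono)
  also have "\<dots> \<le> (LINT u:{0<..}|lborel. exp (- (c * u powr \<beta>))) / pi"
  proof (intro divide_right_mono)
    have si: "set_integrable lborel {0<..} (rotated_kernel \<beta> t s)"
      using assms s by (intro set_integrable_rotated_kernel) auto
    have "norm (LINT u:{0<..}|lborel. rotated_kernel \<beta> t s u) \<le> (LINT u:{0<..}|lborel. norm (rotated_kernel \<beta> t s u))"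
      by (rule set_integral_norm_bound[OF si])
    also have "\<dots> \<le> (LINT u:{0<..}|lborel. exp (- (c * u powr \<beta>)))"
      using rotation_angle[OF \<beta>] s
      by (intro set_integral_mono set_integrable_norm[OF si] set_integrable_exp_neg_powr c \<beta>)
         (auto simp: norm_rotated_kernel c_def)
    finally show "norm (LINT u:{0<..}|lborel. rotated_kernel \<beta> t s u) \<le> (LINT u:{0<..}|lborel. exp (- (c * u powr \<beta>)))" .
  qed auto
  finally show "\<bar>subordinator_density \<beta> t s\<bar> \<le> (LINT u:{0<..}|lborel. exp (- (t * cos (rotation_angle \<beta>) * u powr \<beta>))) / pi"
    by (simp add: c_def)
qed

text \<open>The term \<open>k = 0\<close> of the series vanishes (this is \<open>1 / Gamma 0 = 0\<close>), and every other power
  \<open>s powr (- \<beta> * k - 1)\<close> is at most \<open>s powr (- \<beta> - 1)\<close> for \<open>s \<ge> 1\<close>.\<close>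
lemma subordinator_density_tail:
  fixes t \<beta> :: real
  assumes \<beta>: "0 < \<beta>" "\<beta> < 1" and t: "t > 0"
  shows "\<exists>C. \<forall>s\<ge>1. \<bar>subordinator_density \<beta> t s\<bar> \<le> C * s powr (- \<beta> - 1)"
proof -
  define a where "a k = t ^ k / fact k * Gamma (\<beta> * k + 1)" for k :: nat
  have a: "summable a"
    using wright_series_eq_integral(1)[OF \<beta> _ t, of 1] by (simp add: a_def[abs_def])
  have Gp: "Gamma (\<beta> * k + 1) > 0" for k :: nat
    using \<beta> by (intro Gamma_real_pos add_nonneg_pos) auto
  have a0: "a k \<ge> 0" for k using t Gp[of k] by (simp add: a_def)
  have "\<bar>subordinator_density \<beta> t s\<bar> \<le> suminf a * s powr (- \<beta> - 1)" if s: "s \<ge> 1" for s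
  proof -
    define b where "b k = (- t) ^ k / fact k * (Gamma (\<beta> * k + 1) * s powr (- (\<beta> * k) - 1)) * (- sin (pi * (\<beta> * k)) / pi)" for k :: nat
    have b: "b sums subordinator_density \<beta> t s"
      using subordinator_density_sums[OF \<beta> _ t, of s] s by (simp add: b_def[abs_def])
    have ba: "norm (b k) \<le> a k * s powr (- \<beta> - 1)" for k
    proof (cases "k = 0")
      case True
      then show ?thesis using a0 by (simp add: b_def)
    next
      case False
      have "norm (b k) = a k * s powr (- (\<beta> * k) - 1) * (\<bar>sin (pi * (\<beta> * k))\<bar> / pi)"
        using t Gp[of k] by (simp add: b_def a_def abs_mult power_abs)
      also have "\<dots> \<le> a k * s powr (- (\<beta> * k) - 1) * 1"
      proof (rule mult_left_mono)
        have "\<bar>sin (pi * (\<beta> * k))\<bar> \<le> 1" by (rule abs_sin_le_one)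
        also have "1 \<le> pi" using pi_ge_two by simp
        finally show "\<bar>sin (pi * (\<beta> * k))\<bar> / pi \<le> 1" by simp
      qed (use a0 in auto)
      also have "\<dots> \<le> a k * s powr (- \<beta> - 1)"
        using False \<beta> s a0[of k] by (auto intro!: mult_left_mono powr_mono)
      finally show ?thesis .
    qed
    have sm: "summable (\<lambda>k. a k * s powr (- \<beta> - 1))" using a by (rule summable_mult2)
    have "norm (suminf b) \<le> (\<Sum>k. a k * s powr (- \<beta> - 1))"
      by (rule norm_suminf_le[OF ba sm])
    also have "\<dots> = suminf a * s powr (- \<beta> - 1)" by (rule suminf_mult2[OF a, symmetric])
    finally show ?thesis using b by (simp add: sums_iff)
  qed
  then show ?thesis by blast
qed

lemma subordinator_density_integrable:
  fixes t \<beta> :: real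
  assumes \<beta>: "0 < \<beta>" "\<beta> < 1" and t: "t > 0"
  shows "set_integrable lborel {0<..} (subordinator_density \<beta> t)"
proof -
  obtain M where M: "\<And>s. s > 0 \<Longrightarrow> \<bar>subordinator_density \<beta> t s\<bar> \<le> M"
    using subordinator_density_bounded[OF assms] by blast
  obtain C where C: "\<And>s. s \<ge> 1 \<Longrightarrow> \<bar>subordinator_density \<beta> t s\<bar> \<le> C * s powr (- \<beta> - 1)"
    using subordinator_density_tail[OF assms] by blast
  show ?thesis
    by (rule set_integrable_half_line[where U = 1 and e = "- \<beta> - 1" and M = M and C = C]) (use M C \<beta> in auto)
qed

section \<open>The Laplace transform of the density\<close>

text \<open>The antiderivative of the integrand is \<open>Ln (l - z) - Ln (z + 1)\<close>, taken along \<open>z = u * e\<close>.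
  Writing \<open>l - z\<close> instead of \<open>z - l\<close> keeps the path off the branch cut, since it starts at the positive
  number \<open>l\<close>. In the limit only the directions \<open>- e\<close> and \<open>e\<close> matter.\<close>
lemma Im_log_ray_limit:
  fixes e :: complex and l :: real
  assumes e: "Im e < 0" and l: "l > 0"
  defines "k \<equiv> \<lambda>u. e / (of_real u * e - of_real l) - e / (of_real u * e + 1)"
  shows "((\<lambda>R. Im (integral {0..R} k)) \<longlongrightarrow> Im (Ln (- e)) - Im (Ln e)) at_top"
    and "\<And>R. R \<ge> 0 \<Longrightarrow> k integrable_on {0..R}"
proof -
  define P where "P z = Ln (of_real l - z * e) - Ln (z * e + 1)" for z
  have FTC: "(k has_integral (P (of_real R) - P (of_real 0))) {0..R}" if R: "R \<ge> 0" for R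
  proof (intro fundamental_theorem_of_calculus has_vector_derivative_real_field R)
    fix u assume u: "u \<in> {0..R}"
    have 1: "of_real l - of_real u * e \<notin> \<real>\<^sub>\<le>\<^sub>0" and 2: "of_real u * e + 1 \<notin> \<real>\<^sub>\<le>\<^sub>0"
      using u e l by (auto simp: complex_nonpos_Reals_iff)
    then have "of_real l - of_real u * e \<noteq> 0" "of_real u * e + 1 \<noteq> 0" by auto
    then have 3: "of_real u * e - of_real l \<noteq> 0" "of_real u * e + 1 \<noteq> 0" by auto
    have "(P has_field_derivative (- e / (of_real l - of_real u * e) - e / (of_real u * e + 1))) (at (of_real u))"
      unfolding P_def using 1 2 by (auto intro!: derivative_eq_intros simp: divide_inverse)
    also have "- e / (of_real l - of_real u * e) = e / (of_real u * e - of_real l)"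
      by (metis minus_diff_eq minus_divide_divide minus_minus)
    finally show "(P has_field_derivative k u) (at (of_real u))"
      unfolding k_def .
  qed
  show "k integrable_on {0..R}" if "R \<ge> 0" for R using FTC[OF that] by (rule has_integral_integrable)
  have ev: "eventually (\<lambda>R. Im (Ln (of_real (l / R) - e)) - Im (Ln (e + of_real (1 / R))) = Im (integral {0..R} k)) at_top"
    using eventually_gt_at_top[of 0]
  proof eventually_elim
    fix R :: real assume R: "R > 0"
    have 1: "of_real l - of_real R * e = of_real R * (of_real (l / R) - e)"
      and 2: "of_real R * e + 1 = of_real R * (e + of_real (1 / R))"
      using R by (simp_all add: algebra_simps)
    have "of_real (l / R) - e \<noteq> 0" "e + of_real (1 / R) \<noteq> 0"
      using e by (auto simp: complex_eq_iff)
    note Ln = Ln_times_of_real[OF R this(1)] Ln_times_of_real[OF R this(2)]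
    have "P (of_real R) = Ln (of_real (l / R) - e) - Ln (e + of_real (1 / R))"
      unfolding P_def 1 2 Ln by (rule add_diff_cancel_left)
    moreover have "P (of_real 0) = of_real (ln l)" using l by (simp add: P_def Ln_of_real)
    moreover have "integral {0..R} k = P (of_real R) - P (of_real 0)"
      using FTC[of R] R by (simp add: has_integral_iff)
    ultimately show "Im (Ln (of_real (l / R) - e)) - Im (Ln (e + of_real (1 / R))) = Im (integral {0..R} k)"
      by simp
  qed
  have "((\<lambda>R. l / R) \<longlongrightarrow> 0) at_top" "((\<lambda>R. 1 / R) \<longlongrightarrow> (0::real)) at_top" by real_asymp+
  then have "((\<lambda>R. Im (Ln (of_real (l / R) - e)) - Im (Ln (e + of_real (1 / R)))) \<longlongrightarrow>
     Im (Ln (of_real 0 - e)) - Im (Ln (e + of_real 0))) at_top"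
    using e by (intro tendsto_intros) (auto simp: complex_nonpos_Reals_iff)
  from Lim_transform_eventually[OF this ev]
  show "((\<lambda>R. Im (integral {0..R} k)) \<longlongrightarrow> Im (Ln (- e)) - Im (Ln e)) at_top" by simp
qed

text \<open>A residue computation without residues. With \<open>F z = exp (- t * z powr \<beta>)\<close> and
  \<open>e = - cis \<theta>\<close>, the integrand is \<open>e * F (u * e) / (u * e - l)\<close>. Subtracting
  \<open>F l * (l + 1) / (z + 1)\<close> from \<open>F z\<close> removes the singularity at \<open>l\<close> and leaves a function \<open>h\<close> whose
  ray integral may be rotated onto the positive axis, where \<open>h\<close> is real. So the imaginary part comes
  entirely from the subtracted term, \<open>F l * (1 / (z - l) - 1 / (z + 1))\<close> by partial fractions, and
  that is a difference of logarithms whose argument changes by \<open>pi\<close>.\<close>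
lemma Im_resolvent_integral:
  fixes l t \<beta> :: real
  assumes \<beta>: "0 < \<beta>" "\<beta> < 1" and t: "t > 0" and l: "l > 0"
  defines "\<theta> \<equiv> rotation_angle \<beta>"
  defines "q \<equiv> \<lambda>u. cis \<theta> * (exp (- of_real (t * u powr \<beta>) * cis (- \<theta>)) / (of_real l + of_real u * cis \<theta>))"
  shows "set_integrable lborel {0<..} q"
    and "Im (LINT u:{0<..}|lborel. q u) = pi * exp (- t * l powr \<beta>)"
proof -
  note \<theta> = rotation_angle[OF \<beta>, folded \<theta>_def]
  define \<psi> where "\<psi> = pi - \<theta>"
  have \<psi>: "0 < \<psi>" "\<psi> < pi" using \<theta> by (auto simp: \<psi>_def)
  have \<beta>\<psi>: "\<beta> * \<psi> = \<theta>" using \<theta>(3) by (simp add: \<psi>_def)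
  define e where "e = cis (- \<psi>)"
  have e: "e = - cis \<theta>" by (simp add: e_def \<psi>_def complex_eq_iff)
  have Im_e: "Im e < 0" using \<theta> by (simp add: e)
  define c where "c = t * cos \<theta>"
  have c: "c > 0" using \<theta> t by (simp add: c_def)
  show qi: "set_integrable lborel {0<..} q"
  proof (rule set_integrable_bound)
    show "set_integrable lborel {0<..} (\<lambda>u. 1 / l * exp (- (c * u powr \<beta>)))"
      by (intro set_integrable_mult_right set_integrable_exp_neg_powr c \<beta>)
    have "norm (q u) \<le> 1 / l * exp (- (c * u powr \<beta>))" if "u > 0" for u
    proof -
      have "l \<le> Re (of_real l + of_real u * cis \<theta>)" using \<theta> that by simp
      also have "\<dots> \<le> norm (of_real l + of_real u * cis \<theta>)" by (rule complex_Re_le_cmod)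
      finally have "l \<le> norm (of_real l + of_real u * cis \<theta>)" .
      moreover have "norm (q u) = exp (- (c * u powr \<beta>)) / norm (of_real l + of_real u * cis \<theta>)"
        by (simp add: q_def norm_mult norm_divide norm_exp_eq_Re c_def mult_ac)
      ultimately show ?thesis using l by (simp add: frac_le)
    qed
    then show "AE u in lborel. u \<in> {0<..} \<longrightarrow> norm (q u) \<le> norm (1 / l * exp (- (c * u powr \<beta>)))"
      using l by (auto intro!: always_eventually)
    show "set_borel_measurable lborel {0<..} q"
      unfolding q_def set_borel_measurable_def by measurable
  qed
  define F where "F z = exp (- of_real t * z powr of_real \<beta>)" for z :: complex
  define Fl where "Fl = exp (- t * l powr \<beta>)"
  have Fl: "F (of_real l) = of_real Fl"
    using l by (simp add: F_def Fl_def powr_of_real flip: exp_of_real)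
  \<comment> \<open>The subtracted term agrees with \<open>F\<close> at \<open>l\<close>, is real on the positive axis, and has its pole \<open>-1\<close> outside the sector.\<close>
  define N where "N z = F z - of_real (Fl * (l + 1)) / (z + 1)" for z
  define h where "h z = (if z = of_real l then deriv N (of_real l) else N z / (z - of_real l))" for z
  have F_holo: "F holomorphic_on - \<real>\<^sub>\<le>\<^sub>0"
    unfolding F_def by (intro holomorphic_intros) auto
  have N_holo: "N holomorphic_on - \<real>\<^sub>\<le>\<^sub>0"
    unfolding N_def using F_holo
    by (intro holomorphic_intros) (auto simp: complex_nonpos_Reals_iff add_eq_0_iff2)
  have Nl: "N (of_real l) = 0"
  proof -
    have "N (of_real l) = of_real (Fl - Fl * (l + 1) / (l + 1))"
      by (simp only: N_def Fl of_real_diff of_real_divide of_real_add of_real_1)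
    then show ?thesis using l by simp
  qed
  have l_in: "of_real l \<in> - (\<real>\<^sub>\<le>\<^sub>0 :: complex set)" using l by (auto simp: complex_nonpos_Reals_iff)
  have z1: "z + 1 \<noteq> 0" if "z \<in> sector e" for z
  proof
    assume "z + 1 = 0"
    then have "z = -1" by (simp add: eq_neg_iff_add_eq_0)
    then show False using lower_sector_arg(2)[OF that[unfolded e_def] \<psi>] by (auto simp: complex_nonpos_Reals_iff)
  qed
  have contF: "continuous_on (sector e) F"
  proof -
    have "((\<lambda>z. exp (- of_real t * z powr of_real \<beta>)) \<longlongrightarrow> exp (- of_real t * z powr of_real \<beta>)) (at z within sector e)" 
      if "z \<in> sector e" for z
      using lower_sector_arg(2)[OF that[unfolded e_def] \<psi>] \<beta> by (intro tendsto_intros) auto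
    then show ?thesis by (auto simp: continuous_on_def F_def[abs_def])
  qed
  have contN: "continuous_on (sector e) N"
    unfolding N_def using z1 by (intro continuous_intros contF) auto
  have lim: "((\<lambda>R. integral {0..R} (\<lambda>u. h (of_real u)) - e * integral {0..R} (\<lambda>u. h (of_real u * e))) \<longlongrightarrow> 0) at_top"
    and conth: "continuous_on (sector e) h"
  proof -
    show conth: "continuous_on (sector e) h"
      unfolding continuous_on_def
    proof
      fix z assume z: "z \<in> sector e"
      show "(h \<longlongrightarrow> h z) (at z within sector e)"
      proof (cases "z = of_real l")
        case True
        have "N field_differentiable at (of_real l)"
          using l_in by (intro holomorphic_on_imp_differentiable_at[OF N_holo]) auto
        then have "(N has_field_derivative deriv N (of_real l)) (at (of_real l))"
          by (simp add: field_differentiable_derivI)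
        then have "((\<lambda>y. (N y - N (of_real l)) / (y - of_real l)) \<longlongrightarrow> deriv N (of_real l)) (at (of_real l))"
          by (simp add: has_field_derivative_iff)
        then have "(h \<longlongrightarrow> deriv N (of_real l)) (at (of_real l))"
          by (rule Lim_transform_eventually) (auto simp: h_def Nl eventually_at_filter)
        then show ?thesis using True by (auto simp: h_def intro: tendsto_within_subset)
      next
        case False
        have "((\<lambda>z. N z / (z - of_real l)) \<longlongrightarrow> N z / (z - of_real l)) (at z within sector e)"
          using contN z False by (intro tendsto_intros) (auto simp: continuous_on_def)
        moreover have "eventually (\<lambda>y. y \<noteq> of_real l) (at z within sector e)"
          using False by (metis eventually_neq_at_within)
        then have "eventually (\<lambda>y. N y / (y - of_real l) = h y) (at z within sector e)"
          by eventually_elim (auto simp: h_def)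
        ultimately have "(h \<longlongrightarrow> N z / (z - of_real l)) (at z within sector e)"
          by (rule Lim_transform_eventually)
        then show ?thesis using False by (simp add: h_def)
      qed
    qed
    define K where "K = Fl * (l + 1)"
    have K: "K > 0" using l by (simp add: K_def Fl_def)
    show "((\<lambda>R. integral {0..R} (\<lambda>u. h (of_real u)) - e * integral {0..R} (\<lambda>u. h (of_real u * e))) \<longlongrightarrow> 0) at_top"
    proof (rule ray_rotation[OF _ conth, where B\<^sub>0 = "l + 2" and g = "\<lambda>x. x * ((exp (- (c * x powr \<beta>)) + K / (x - 1)) / (x - l))"])
      show "Im e \<noteq> 0" using Im_e by simp
      show "h field_differentiable at z" if z: "z \<in> interior (sector e)" for z
      proof -
        have "z \<in> interior {z. Im z \<le> 0}"
          using z interior_mono[of "sector e" "{z. Im z \<le> 0}"] lower_sector_arg(1)[OF _ \<psi>] by (auto simp: e_def)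
        then have Im: "Im z < 0" using interior_halfspace_le[of \<i> 0] by simp
        have "h holomorphic_on {z. Im z < 0}"
        proof (rule holomorphic_transform)
          show "(\<lambda>z. N z / (z - of_real l)) holomorphic_on {z. Im z < 0}"
            by (intro holomorphic_intros holomorphic_on_subset[OF N_holo])
               (auto simp: complex_nonpos_Reals_iff)
        qed (auto simp: h_def)
        then show ?thesis
          using Im by (intro holomorphic_on_imp_differentiable_at[of h "{z. Im z < 0}"]) (auto simp: open_halfspace_Im_lt)
      qed
      show "norm z * norm (h z) \<le> norm z * ((exp (- (c * norm z powr \<beta>)) + K / (norm z - 1)) / (norm z - l))"
        if z: "z \<in> sector e" "l + 2 \<le> norm z" for z
      proof (rule mult_left_mono)
        have zl: "z \<noteq> of_real l" using z l by auto
        have "norm (N z) \<le> norm (F z) + norm (of_real (Fl * (l + 1)) / (z + 1))"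
          unfolding N_def by (rule norm_triangle_ineq4)
        moreover have "norm (F z) \<le> exp (- (c * norm z powr \<beta>))"
        proof -
          have "norm z powr \<beta> * cos \<theta> \<le> Re (z powr of_real \<beta>)"
            using Re_powr_sector[OF z(1)[unfolded e_def] \<psi> \<beta>] by (simp add: \<beta>\<psi>)
          then have "t * (norm z powr \<beta> * cos \<theta>) \<le> t * Re (z powr of_real \<beta>)"
            using t by (intro mult_left_mono) auto
          then show ?thesis by (simp add: F_def norm_exp_eq_Re c_def mult_ac)
        qed
        moreover have "norm (of_real (Fl * (l + 1)) / (z + 1)) \<le> K / (norm z - 1)"
        proof -
          have "norm z - 1 \<le> norm (z + 1)" using norm_diff_ineq[of z 1] by simp
          then show ?thesis unfolding K_def[symmetric] norm_divide norm_of_real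
            using K z l by (intro frac_le) auto
        qed
        moreover have "norm z - l \<le> norm (z - of_real l)" using norm_triangle_ineq2[of z "of_real l"] l by simp
        moreover have "norm z - l > 0" using z by simp
        ultimately have "norm (N z) / norm (z - of_real l) \<le> (exp (- (c * norm z powr \<beta>)) + K / (norm z - 1)) / (norm z - l)"
          by (intro frac_le) (use K z l in auto)
        then show "norm (h z) \<le> (exp (- (c * norm z powr \<beta>)) + K / (norm z - 1)) / (norm z - l)"
          using zl by (simp add: h_def norm_divide)
      qed auto
      show "((\<lambda>x. x * ((exp (- (c * x powr \<beta>)) + K / (x - 1)) / (x - l))) \<longlongrightarrow> 0) at_top"
        using c \<beta> by real_asymp
    qed
  qed
  have sector_mem: "of_real a + of_real b * e \<in> sector e" if "a \<ge> 0" "b \<ge> 0" for a b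
    unfolding sector_def using that by blast
  have ray: "of_real u * e \<in> sector e" and line: "of_real u \<in> sector e" if "u \<ge> 0" for u
    using sector_mem[of 0 u] sector_mem[of u 0] that by simp_all
  have real_part: "Im (integral {0..R} (\<lambda>u. h (of_real u))) = 0" for R
  proof -
    have "continuous_on {0..R} (\<lambda>u. h (of_real u))"
      by (intro continuous_on_compose2[OF conth] continuous_intros) (auto intro: line)
    then have int: "(\<lambda>u. h (of_real u)) integrable_on {0..R}" by (rule integrable_continuous_real)
    have "Im (integral {0..R} (\<lambda>u. h (of_real u))) = integral {0..R} (Im \<circ> (\<lambda>u. h (of_real u)))"
      using integral_linear[OF int bounded_linear_Im] by simp
    also have "\<dots> = integral {0..R} (\<lambda>_. 0)"
    proof (rule integral_spike[of "{l}"])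
      fix u assume u: "u \<in> {0..R} - {l}"
      have "h (of_real u) = of_real ((exp (- t * u powr \<beta>) - Fl * (l + 1) / (u + 1)) / (u - l))"
        using u by (simp add: h_def N_def F_def powr_of_real exp_of_real[symmetric])
      then show "0 = (Im \<circ> (\<lambda>u. h (of_real u))) u" by (simp only: o_def Im_complex_of_real)
    qed auto
    finally show ?thesis by simp
  qed
  define k where "k u = e / (of_real u * e - of_real l) - e / (of_real u * e + 1)" for u :: real
  have split: "e * h (of_real u * e) = q u - of_real Fl * k u" if u: "u \<ge> 0" for u
  proof -
    have ne: "of_real u * e - of_real l \<noteq> 0" "of_real u * e + 1 \<noteq> 0"
    proof -
      show "of_real u * e - of_real l \<noteq> 0"
        using u l Im_e by (cases "u = 0") (auto simp: complex_eq_iff)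
      show "of_real u * e + 1 \<noteq> 0" using z1[OF ray[OF u]] .
    qed
    have "F (of_real u * e) = exp (- of_real (t * u powr \<beta>) * cis (- \<theta>))"
      unfolding F_def e_def using u \<psi> \<beta>\<psi> by (subst of_real_cis_powr) (auto simp: mult_ac)
    then have "q u = - e * F (of_real u * e) / - (of_real u * e - of_real l)"
      by (simp add: q_def e add.commute)
    then have q: "q u = e * F (of_real u * e) / (of_real u * e - of_real l)"
      by (simp only: minus_divide_divide mult_minus_left)
    have "h (of_real u * e) = N (of_real u * e) / (of_real u * e - of_real l)"
      using ne by (simp add: h_def)
    then have "e * h (of_real u * e) = q u - of_real Fl * (e * (of_real l + 1) / ((of_real u * e + 1) * (of_real u * e - of_real l)))"
      unfolding q N_def by (simp add: diff_divide_distrib right_diff_distrib mult_ac)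
    also have "e * (of_real l + 1) / ((of_real u * e + 1) * (of_real u * e - of_real l)) = k u"
      unfolding k_def using ne by (simp add: divide_simps) (simp add: algebra_simps)
    finally show ?thesis .
  qed
  have "eventually (\<lambda>R. - Im (integral {0..R} (\<lambda>u. h (of_real u)) - e * integral {0..R} (\<lambda>u. h (of_real u * e)))
      = Im (integral {0..R} q) - Fl * Im (integral {0..R} k)) at_top"
    using eventually_ge_at_top[of 0]
  proof eventually_elim
    fix R :: real assume R: "R \<ge> 0"
    have ki: "k integrable_on {0..R}"
      unfolding k_def by (rule Im_log_ray_limit(2)[OF Im_e l R])
    have "continuous_on {0..R} (\<lambda>u. h (of_real u * e))"
      by (intro continuous_on_compose2[OF conth] continuous_intros) (auto intro: ray)
    then have hi: "(\<lambda>u. e * h (of_real u * e)) integrable_on {0..R}"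
      by (intro integrable_continuous_real continuous_intros)
    have "e * integral {0..R} (\<lambda>u. h (of_real u * e)) = integral {0..R} (\<lambda>u. e * h (of_real u * e))"
      by simp
    also have "\<dots> = integral {0..R} (\<lambda>u. q u - of_real Fl * k u)"
      using split by (intro integral_cong) auto
    also have "\<dots> = integral {0..R} q - integral {0..R} (\<lambda>u. of_real Fl * k u)"
    proof (rule integral_diff)
      show kk: "(\<lambda>u. of_real Fl * k u) integrable_on {0..R}"
        using ki by (rule integrable_on_mult_right)
      have "(\<lambda>u. e * h (of_real u * e) + of_real Fl * k u) integrable_on {0..R}"
        by (rule integrable_add[OF hi kk])
      then show "q integrable_on {0..R}" by (rule integrable_eq) (use split in auto)
    qed
    finally have "e * integral {0..R} (\<lambda>u. h (of_real u * e)) = integral {0..R} q - of_real Fl * integral {0..R} k" by simp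
    then show "- Im (integral {0..R} (\<lambda>u. h (of_real u)) - e * integral {0..R} (\<lambda>u. h (of_real u * e)))
      = Im (integral {0..R} q) - Fl * Im (integral {0..R} k)"
      using real_part[of R] by simp
  qed
  moreover have "((\<lambda>R. - Im (integral {0..R} (\<lambda>u. h (of_real u)) - e * integral {0..R} (\<lambda>u. h (of_real u * e)))) \<longlongrightarrow> - Im 0) at_top"
    by (intro tendsto_intros lim)
  ultimately have "((\<lambda>R. Im (integral {0..R} q) - Fl * Im (integral {0..R} k)) \<longlongrightarrow> - Im 0) at_top"
    by (rule Lim_transform_eventually[rotated])
  moreover have "((\<lambda>R. Im (integral {0..R} q) - Fl * Im (integral {0..R} k)) \<longlongrightarrow>
     Im (LINT u:{0<..}|lborel. q u) - Fl * (Im (Ln (- e)) - Im (Ln e))) at_top"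
    unfolding k_def by (intro tendsto_intros tendsto_integral_half_line qi Im_log_ray_limit(1) Im_e l)
  ultimately have "- Im 0 = Im (LINT u:{0<..}|lborel. q u) - Fl * (Im (Ln (- e)) - Im (Ln e))"
    by (rule tendsto_unique[rotated]) simp
  moreover have "Ln (- e) = \<i> * of_real \<theta>"
    unfolding e minus_minus cis_conv_exp using \<theta> by (intro Ln_exp) auto
  moreover have "Ln e = \<i> * of_real (- \<psi>)"
    unfolding e_def cis_conv_exp using \<psi> by (intro Ln_exp) auto
  ultimately show "Im (LINT u:{0<..}|lborel. q u) = pi * exp (- t * l powr \<beta>)"
    by (simp add: Fl_def \<psi>_def)
qed

text \<open>By Fubini's theorem the transform in \<open>s\<close> replaces the kernel \<open>exp (- s * u * cis \<theta>)\<close> by the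
  resolvent \<open>1 / (l + u * cis \<theta>)\<close>.\<close>
lemma subordinator_density_laplace:
  fixes l t \<beta> :: real
  assumes \<beta>: "0 < \<beta>" "\<beta> < 1" and t: "t > 0" and l: "l > 0"
  shows "(LINT s:{0<..}|lborel. exp (- l * s) * subordinator_density \<beta> t s) = exp (- t * l powr \<beta>)"
proof -
  define \<theta> where "\<theta> = rotation_angle \<beta>"
  note \<theta> = rotation_angle[OF \<beta>, folded \<theta>_def]
  define c where "c = t * cos \<theta>"
  have c: "c > 0" using \<theta> t by (simp add: c_def)
  define f where "f s u = indicator {0<..} s *\<^sub>R indicator {0<..} u *\<^sub>R (of_real (exp (- (l * s))) * rotated_kernel \<beta> t s u)"
    for s u :: real
  have f_meas [measurable]: "(\<lambda>(s, u). f s u) \<in> borel_measurable (lborel \<Otimes>\<^sub>M lborel)"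
    unfolding f_def by measurable
  have d1: "integrable lborel (\<lambda>s. indicator {0<..} s * exp (- (l * s)))"
    using set_integrable_exp_neg[OF l] by (simp add: set_integrable_def)
  have d2: "integrable lborel (\<lambda>u. indicator {0<..} u * exp (- (c * u powr \<beta>)))"
    using set_integrable_exp_neg_powr[OF c \<beta>(1)] by (simp add: set_integrable_def)
  have bound: "norm (f s u) \<le> (indicator {0<..} s * exp (- (l * s))) * (indicator {0<..} u * exp (- (c * u powr \<beta>)))" for s u
  proof (cases "s > 0 \<and> u > 0")
    case True
    have "s * cos \<theta> * u \<ge> 0" using True \<theta> by auto
    then have "norm (rotated_kernel \<beta> t s u) \<le> exp (- (c * u powr \<beta>))"
      by (simp add: norm_rotated_kernel c_def \<theta>_def[symmetric])
    then show ?thesis using True by (simp add: f_def norm_mult mult_left_mono)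
  qed (auto simp: f_def)
  note f_dom = f_meas d1 d2 bound
  have "(LINT s:{0<..}|lborel. exp (- l * s) * subordinator_density \<beta> t s)
    = Im (cis \<theta> * (LINT s|lborel. LINT u|lborel. f s u)) / pi"
  proof -
    have int: "integrable lborel (\<lambda>s. LINT u|lborel. f s u)"
      by (rule integrable_inner_dominated[OF f_dom])
    have eq: "indicator {0<..} s *\<^sub>R (exp (- l * s) * subordinator_density \<beta> t s) = Im (cis \<theta> * (LINT u|lborel. f s u)) / pi" for s
    proof -
      have "(LINT u|lborel. f s u) = (LINT u|lborel. (indicator {0<..} s * of_real (exp (- (l * s)))) * (indicator {0<..} u *\<^sub>R rotated_kernel \<beta> t s u))"
        unfolding f_def by (intro Bochner_Integration.integral_cong) (auto simp: indicator_def)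
      also have "\<dots> = (indicator {0<..} s * of_real (exp (- (l * s)))) * (LINT u:{0<..}|lborel. rotated_kernel \<beta> t s u)"
        unfolding set_lebesgue_integral_def by (rule integral_mult_right_zero)
      also have "\<dots> = of_real (indicator {0<..} s * exp (- (l * s))) * (LINT u:{0<..}|lborel. rotated_kernel \<beta> t s u)"
        by (simp add: indicator_def)
      finally have "cis \<theta> * (LINT u|lborel. f s u) = of_real (indicator {0<..} s * exp (- (l * s))) * (cis \<theta> * (LINT u:{0<..}|lborel. rotated_kernel \<beta> t s u))"
        by (simp only: mult.left_commute)
      moreover have "Im (complex_of_real a * z) = a * Im z" for a z by simp
      ultimately show ?thesis by (simp only: subordinator_density_def \<theta>_def[symmetric]) simp
    qed
    have "(LINT s|lborel. Im (cis \<theta> * (LINT u|lborel. f s u))) = Im (LINT s|lborel. cis \<theta> * (LINT u|lborel. f s u))"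
      using int by (intro integral_Im) auto
    then show ?thesis unfolding set_lebesgue_integral_def eq by simp
  qed
  also have "(LINT s|lborel. LINT u|lborel. f s u) = (LINT u|lborel. LINT s|lborel. f s u)"
    by (rule integral_swap_dominated[OF f_dom])
  also have "(\<lambda>u. LINT s|lborel. f s u) = (\<lambda>u. indicator {0<..} u *\<^sub>R (exp (- of_real (t * u powr \<beta>) * cis (- \<theta>)) / (of_real l + of_real u * cis \<theta>)))"
  proof
    fix u
    show "(LINT s|lborel. f s u) = indicator {0<..} u *\<^sub>R (exp (- of_real (t * u powr \<beta>) * cis (- \<theta>)) / (of_real l + of_real u * cis \<theta>))"
    proof (cases "u > 0")
      case True
      have Re: "Re (of_real l + of_real u * cis \<theta>) > 0" using l True \<theta> by (simp add: add_pos_pos)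
      have "f s u = exp (- of_real (t * u powr \<beta>) * cis (- \<theta>)) *
           (indicator {0<..} s *\<^sub>R exp (- of_real s * (of_real l + of_real u * cis \<theta>)))" for s
        using True unfolding f_def rotated_kernel_def exp_of_real[symmetric]
        by (simp add: \<theta>_def[symmetric] exp_add[symmetric] algebra_simps)
      then have "(LINT s|lborel. f s u) = exp (- of_real (t * u powr \<beta>) * cis (- \<theta>)) *
           (LINT s:{0<..}|lborel. exp (- of_real s * (of_real l + of_real u * cis \<theta>)))"
        unfolding set_lebesgue_integral_def by (simp only: integral_mult_right_zero)
      then show ?thesis using True by (simp add: exp_half_line_integral(2)[OF Re, simplified])
    qed (simp add: f_def)
  qed
  also have "cis \<theta> * (LINT u|lborel. indicator {0<..} u *\<^sub>R (exp (- of_real (t * u powr \<beta>) * cis (- \<theta>)) / (of_real l + of_real u * cis \<theta>)))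
    = (LINT u:{0<..}|lborel. cis \<theta> * (exp (- of_real (t * u powr \<beta>) * cis (- \<theta>)) / (of_real l + of_real u * cis \<theta>)))"
    unfolding set_integral_mult_right unfolding set_lebesgue_integral_def ..
  also have "Im \<dots> = pi * exp (- t * l powr \<beta>)"
    unfolding \<theta>_def by (rule Im_resolvent_integral(2)[OF assms])
  finally show ?thesis by simp
qed

section \<open>The heat kernel and its Fourier transform\<close>

lemma gaussian_fourier_real:
  fixes \<epsilon> z :: real
  assumes \<epsilon>: "\<epsilon> > 0"
  shows "integrable lborel (\<lambda>x. exp (\<i> * of_real (z * x)) * of_real (exp (- \<epsilon> * x\<^sup>2)))"
    and "(LINT x|lborel. exp (\<i> * of_real (z * x)) * of_real (exp (- \<epsilon> * x\<^sup>2)))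
      = of_real (sqrt (pi / \<epsilon>) * exp (- z\<^sup>2 / (4 * \<epsilon>)))"
proof -
  define c where "c = sqrt (2 * \<epsilon>)"
  have c: "c > 0" "c\<^sup>2 = 2 * \<epsilon>" using \<epsilon> by (auto simp: c_def)
  define f where "f x = exp (\<i> * of_real (z / c * x)) * of_real (std_normal_density x)" for x
  have fi: "integrable lborel f"
  proof (rule Bochner_Integration.integrable_bound)
    show "integrable lborel std_normal_density" by (rule integrable_normal_density) simp
    show "f \<in> borel_measurable lborel" unfolding f_def by measurable
    show "AE x in lborel. norm (f x) \<le> norm (std_normal_density x)"
      by (auto simp: f_def norm_mult intro!: always_eventually)
  qed
  have "char std_normal_distribution (z / c) = (LINT x|lborel. f x)"
    unfolding char_def f_def by (subst integral_density) (auto simp: scaleR_conv_of_real mult.commute)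
  then have fv: "(LINT x|lborel. f x) = of_real (exp (- (z / c)\<^sup>2 / 2))"
    by (simp add: char_std_normal_distribution)
  have fc: "f (0 + c * x) = of_real (1 / sqrt (2 * pi)) * (exp (\<i> * of_real (z * x)) * of_real (exp (- \<epsilon> * x\<^sup>2)))" for x
    using c by (simp add: f_def std_normal_density_def power_mult_distrib mult_ac)
  have "integrable lborel (\<lambda>x. f (0 + c * x))"
    using fi c by (subst lborel_integrable_real_affine_iff) auto
  then have "integrable lborel (\<lambda>x. of_real (sqrt (2 * pi)) * f (0 + c * x))" by simp
  then show "integrable lborel (\<lambda>x. exp (\<i> * of_real (z * x)) * of_real (exp (- \<epsilon> * x\<^sup>2)))"
    unfolding fc by (simp flip: mult.assoc of_real_mult)
  have "of_real (exp (- (z / c)\<^sup>2 / 2)) = of_real c * (LINT x|lborel. f (0 + c * x))"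
    unfolding fv[symmetric] using c by (subst lborel_integral_real_affine[where c = c and t = 0]) (auto simp: scaleR_conv_of_real)
  also have "(LINT x|lborel. f (0 + c * x)) = of_real (1 / sqrt (2 * pi)) * (LINT x|lborel. exp (\<i> * of_real (z * x)) * of_real (exp (- \<epsilon> * x\<^sup>2)))"
    unfolding fc by (rule integral_mult_right_zero)
  finally have "(LINT x|lborel. exp (\<i> * of_real (z * x)) * of_real (exp (- \<epsilon> * x\<^sup>2))) =
      of_real (sqrt (2 * pi) / c * exp (- (z / c)\<^sup>2 / 2))"
    using c by (simp add: field_simps)
  also have "sqrt (2 * pi) / c = sqrt (pi / \<epsilon>)" by (simp add: c_def real_sqrt_divide[symmetric])
  also have "- (z / c)\<^sup>2 / 2 = - z\<^sup>2 / (4 * \<epsilon>)" using c by (simp add: power_divide)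
  finally show "(LINT x|lborel. exp (\<i> * of_real (z * x)) * of_real (exp (- \<epsilon> * x\<^sup>2)))
      = of_real (sqrt (pi / \<epsilon>) * exp (- z\<^sup>2 / (4 * \<epsilon>)))" .
qed

text \<open>Lebesgue measure on a Euclidean space is the image of a product measure, and the integrand is a
  product over the coordinates.\<close>
lemma gaussian_fourier:
  fixes z :: "'a :: euclidean_space"
  assumes \<epsilon>: "\<epsilon> > 0"
  shows "integrable lborel (\<lambda>x. exp (\<i> * of_real (x \<bullet> z)) * of_real (exp (- \<epsilon> * (norm x)\<^sup>2)))"
    and "(LINT x|lborel. exp (\<i> * of_real (x \<bullet> z)) * of_real (exp (- \<epsilon> * (norm x)\<^sup>2)))
      = of_real (sqrt (pi / \<epsilon>) ^ DIM('a) * exp (- (norm z)\<^sup>2 / (4 * \<epsilon>)))"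
proof -
  interpret product_sigma_finite "\<lambda>_::'a. lborel :: real measure" ..
  define f where "f b x = exp (\<i> * of_real ((z \<bullet> b) * x)) * of_real (exp (- \<epsilon> * x\<^sup>2))" for b :: 'a and x :: real
  define T where "T = (\<lambda>p. \<Sum>b\<in>Basis. p b *\<^sub>R (b::'a))"
  define h where "h x = exp (\<i> * of_real (x \<bullet> z)) * of_real (exp (- \<epsilon> * (norm x)\<^sup>2))" for x :: 'a
  have fi: "integrable lborel (f b)" for b
    unfolding f_def by (rule gaussian_fourier_real[OF \<epsilon>])
  have fv: "integral\<^sup>L lborel (f b) = of_real (sqrt (pi / \<epsilon>) * exp (- (z \<bullet> b)\<^sup>2 / (4 * \<epsilon>)))" for b
    unfolding f_def by (rule gaussian_fourier_real[OF \<epsilon>])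
  have nrm: "(norm x)\<^sup>2 = (\<Sum>b\<in>Basis. (x \<bullet> b)\<^sup>2)" for x :: 'a
    unfolding power2_norm_eq_inner by (subst euclidean_inner) (simp add: power2_eq_square)
  have prod: "h x = (\<Prod>b\<in>Basis. f b (x \<bullet> b))" for x
    unfolding h_def f_def nrm
    by (subst euclidean_inner) (simp add: prod.distrib exp_sum sum_distrib_left mult.commute flip: exp_of_real)
  have hT: "h (T p) = (\<Prod>b\<in>Basis. f b (p b))" for p
    unfolding prod by (intro prod.cong) (auto simp: T_def)
  have [measurable]: "h \<in> borel_measurable borel" unfolding h_def by measurable
  have [measurable]: "T \<in> measurable (\<Pi>\<^sub>M b\<in>Basis. lborel) borel" unfolding T_def by measurable
  have "integrable (\<Pi>\<^sub>M b\<in>(Basis::'a set). lborel) (\<lambda>p. h (T p))"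
    unfolding hT by (intro product_integrable_prod fi) auto
  then have "integrable lborel h"
    unfolding lborel_eq[where 'a = 'a] T_def[symmetric] by (subst integrable_distr_eq) auto
  then show "integrable lborel (\<lambda>x. exp (\<i> * of_real (x \<bullet> z)) * of_real (exp (- \<epsilon> * (norm x)\<^sup>2)))"
    unfolding h_def .
  have "integral\<^sup>L lborel h = (LINT p|(\<Pi>\<^sub>M b\<in>(Basis::'a set). lborel). h (T p))"
    unfolding lborel_eq[where 'a = 'a] T_def[symmetric] by (subst integral_distr) auto
  also have "\<dots> = (\<Prod>b\<in>Basis. integral\<^sup>L lborel (f b))"
    unfolding hT by (intro product_integral_prod fi) auto
  also have "\<dots> = of_real (sqrt (pi / \<epsilon>) ^ DIM('a) * exp (- (norm z)\<^sup>2 / (4 * \<epsilon>)))"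
    unfolding fv nrm by (simp add: prod.distrib sum_negf[symmetric] sum_divide_distrib flip: of_real_prod exp_sum)
  finally show "(LINT x|lborel. exp (\<i> * of_real (x \<bullet> z)) * of_real (exp (- \<epsilon> * (norm x)\<^sup>2)))
      = of_real (sqrt (pi / \<epsilon>) ^ DIM('a) * exp (- (norm z)\<^sup>2 / (4 * \<epsilon>)))"
    unfolding h_def .
qed

lemma gaussian_integrable:
  assumes "\<epsilon> > 0"
  shows "integrable lborel (\<lambda>x :: 'a :: euclidean_space. exp (- \<epsilon> * (norm x)\<^sup>2))"
  using integrable_norm[OF gaussian_fourier(1)[OF assms, of 0]] by simp

lemma heat_kernel_nonneg: "heat_kernel x t \<ge> 0" if "t > 0"
  using that by (simp add: heat_kernel_def)

lemma heat_kernel_measurable [measurable]: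
  "(\<lambda>x. heat_kernel x t) \<in> borel_measurable borel" "heat_kernel x \<in> borel_measurable borel"
  unfolding heat_kernel_def[abs_def] by measurable

lemma heat_kernel_minus: "heat_kernel (- x) t = heat_kernel x t"
  by (simp add: heat_kernel_def)

lemma heat_kernel_tendsto:
  assumes "s > 0" "e \<longlonglongrightarrow> 0"
  shows "(\<lambda>m. heat_kernel x (s + e m)) \<longlonglongrightarrow> heat_kernel x s"
proof -
  have "(\<lambda>m. heat_kernel x (s + e m)) \<longlonglongrightarrow> heat_kernel x (s + 0)"
    unfolding heat_kernel_def using assms by (intro tendsto_intros) auto
  then show ?thesis by simp
qed

lemma heat_kernel_fourier:
  fixes z :: "real ^ 'n"
  assumes \<epsilon>: "\<epsilon> > 0"
  shows "(LINT x|lborel. exp (\<i> * of_real (x \<bullet> z)) * of_real (exp (- \<epsilon> * (norm x)\<^sup>2)))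
     = of_real ((2 * pi) ^ CARD('n) * heat_kernel z \<epsilon>)"
proof -
  have "sqrt (pi / \<epsilon>) = 2 * pi / sqrt (4 * pi * \<epsilon>)"
  proof -
    have "sqrt (pi / \<epsilon>) * sqrt (4 * pi * \<epsilon>) = sqrt ((2 * pi)\<^sup>2)"
      using \<epsilon> by (simp add: power2_eq_square flip: real_sqrt_mult)
    also have "\<dots> = 2 * pi" unfolding real_sqrt_abs by simp
    finally show ?thesis using \<epsilon> by (simp add: field_simps)
  qed
  then show ?thesis
    unfolding gaussian_fourier(2)[OF \<epsilon>] heat_kernel_def by (simp add: power_divide)
qed

lemma heat_kernel_scale:
  fixes z :: "real ^ 'n"
  assumes "r > 0"
  shows "r ^ CARD('n) * heat_kernel (r *\<^sub>R z) (r\<^sup>2) = heat_kernel z 1"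
proof -
  have "sqrt (4 * pi * r\<^sup>2) = r * sqrt (4 * pi)" using assms by (simp add: real_sqrt_mult)
  then show ?thesis using assms
    by (simp add: heat_kernel_def power_mult_distrib real_sqrt_mult field_simps)
qed

lemma heat_kernel_mass:
  shows "integrable lborel (\<lambda>z :: real ^ 'n. heat_kernel z 1)"
    and "(LINT z|lborel. heat_kernel (z :: real ^ 'n) 1) = 1"
proof -
  have e: "heat_kernel (z :: real ^ 'n) 1 = 1 / sqrt (4 * pi) ^ CARD('n) * exp (- (1 / 4) * (norm z)\<^sup>2)" for z
    by (simp add: heat_kernel_def)
  show "integrable lborel (\<lambda>z :: real ^ 'n. heat_kernel z 1)"
    unfolding e by (intro integrable_mult_right gaussian_integrable) simp
  have "complex_of_real (LINT z|lborel. exp (- (1 / 4) * (norm (z :: real ^ 'n))\<^sup>2)) = of_real (sqrt (4 * pi) ^ CARD('n))"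
    using gaussian_fourier(2)[of "1/4" "0 :: real ^ 'n"]
    by (simp only: inner_zero_right of_real_0 mult_zero_right exp_zero mult_1 integral_complex_of_real) (simp add: mult.commute)
  then show "(LINT z|lborel. heat_kernel (z :: real ^ 'n) 1) = 1"
    unfolding e by (simp only: of_real_eq_iff integral_mult_right_zero) simp
qed

text \<open>Away from the origin the exponential beats the prefactor uniformly in time: with
  \<open>y = \<delta>\<^sup>2 / (4 * \<epsilon>)\<close> the kernel is at most a constant times \<open>sqrt y ^ n * exp (- y)\<close>, where
  \<open>n\<close> is the dimension.\<close>
lemma heat_kernel_bounded_away:
  fixes \<delta> :: real
  assumes \<delta>: "\<delta> > 0"
  shows "\<exists>M. \<forall>\<epsilon>>0. \<forall>z :: real ^ 'n. norm z \<ge> \<delta> \<longrightarrow> heat_kernel z \<epsilon> \<le> M"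
proof (intro exI allI impI)
  fix \<epsilon> :: real and z :: "real ^ 'n"
  assume \<epsilon>: "\<epsilon> > 0" and z: "norm z \<ge> \<delta>"
  let ?n = "CARD('n)"
  define y where "y = \<delta>\<^sup>2 / (4 * \<epsilon>)"
  have y: "y > 0" using \<epsilon> \<delta> by (simp add: y_def)
  have eq: "1 / sqrt (4 * pi * \<epsilon>) = sqrt y / (sqrt pi * \<delta>)"
    using \<epsilon> \<delta> by (simp add: y_def real_sqrt_divide real_sqrt_mult)
  have "heat_kernel z \<epsilon> \<le> 1 / sqrt (4 * pi * \<epsilon>) ^ ?n * exp (- y)"
    unfolding heat_kernel_def y_def using \<epsilon> z \<delta>
    by (intro mult_left_mono) (auto simp: divide_right_mono power_mono)
  also have "1 / sqrt (4 * pi * \<epsilon>) ^ ?n = (1 / sqrt (4 * pi * \<epsilon>)) ^ ?n"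
    by (simp add: power_divide)
  also have "\<dots> = sqrt y ^ ?n / (sqrt pi * \<delta>) ^ ?n"
    unfolding eq power_divide ..
  also have "sqrt y ^ ?n \<le> (1 + y) ^ ?n"
  proof (rule power_mono)
    have "y \<le> (1 + y)\<^sup>2" using y by (simp add: power2_eq_square algebra_simps)
    then show "sqrt y \<le> 1 + y" using y by (simp add: real_le_lsqrt)
  qed (use y in auto)
  also have "(1 + y) ^ ?n \<le> fact ?n * exp (1 + y)"
  proof -
    have s: "(\<lambda>k. (1 + y) ^ k /\<^sub>R fact k) sums exp (1 + y)" by (rule exp_converges)
    have "(1 + y) ^ ?n /\<^sub>R fact ?n \<le> exp (1 + y)"
      using sum_le_suminf[OF sums_summable[OF s], of "{?n}"] sums_unique[OF s] y by simp
    then show ?thesis by (simp add: field_simps)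
  qed
  finally have "heat_kernel z \<epsilon> \<le> fact ?n * exp (1 + y) / (sqrt pi * \<delta>) ^ ?n * exp (- y)"
    using \<delta> by (simp add: divide_right_mono)
  also have "\<dots> = fact ?n * exp 1 / (sqrt pi * \<delta>) ^ ?n"
    by (simp add: exp_add exp_minus field_simps)
  finally show "heat_kernel z \<epsilon> \<le> fact ?n * exp 1 / (sqrt pi * \<delta>) ^ ?n" .
qed

text \<open>Doubling the time trades half of the exponent for a constant factor; the half that is split off tends
  to \<open>0\<close> while the kernel at doubled time stays bounded.\<close>
lemma heat_kernel_vanishes:
  fixes z :: "real ^ 'n"
  assumes z: "z \<noteq> 0" and \<epsilon>: "\<And>m. \<epsilon> m > 0" "\<epsilon> \<longlonglongrightarrow> 0"
  shows "(\<lambda>m. heat_kernel z (\<epsilon> m)) \<longlonglongrightarrow> 0"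
proof -
  obtain M where M: "\<And>e (w :: real ^ 'n). e > 0 \<Longrightarrow> norm w \<ge> norm z \<Longrightarrow> heat_kernel w e \<le> M"
    using heat_kernel_bounded_away[of "norm z"] z by auto
  define a where "a = (norm z)\<^sup>2 / 8"
  have a: "a > 0" using z by (simp add: a_def)
  have double: "heat_kernel z e = sqrt 2 ^ CARD('n) * heat_kernel z (2 * e) * exp (- (a / e))" if "e > 0" for e
  proof -
    have "sqrt (4 * pi * (2 * e)) = sqrt 2 * sqrt (4 * pi * e)" by (simp flip: real_sqrt_mult)
    moreover have "- (norm z)\<^sup>2 / (4 * e) = - (norm z)\<^sup>2 / (4 * (2 * e)) + - (a / e)"
      using that by (simp add: a_def field_simps)
    ultimately show ?thesis
      by (simp only: heat_kernel_def exp_add power_mult_distrib) simp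
  qed
  show ?thesis
  proof (rule tendsto_sandwich[of "\<lambda>_. 0" _ _ "\<lambda>m. sqrt 2 ^ CARD('n) * M * exp (- (a / \<epsilon> m))"])
    show "eventually (\<lambda>m. heat_kernel z (\<epsilon> m) \<le> sqrt 2 ^ CARD('n) * M * exp (- (a / \<epsilon> m))) sequentially"
    proof (intro always_eventually allI)
      fix m
      have "heat_kernel z (2 * \<epsilon> m) \<le> M" using \<epsilon>(1)[of m] by (intro M) auto
      then show "heat_kernel z (\<epsilon> m) \<le> sqrt 2 ^ CARD('n) * M * exp (- (a / \<epsilon> m))"
        unfolding double[OF \<epsilon>(1)] by (intro mult_right_mono mult_left_mono) auto
    qed
    have "filterlim \<epsilon> (at_right 0) sequentially"
      using \<epsilon>(2) by (simp add: filterlim_at \<epsilon>(1) less_imp_neq[OF \<epsilon>(1), symmetric])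
    moreover have "((\<lambda>e. exp (- (a / e))) \<longlongrightarrow> 0) (at_right 0)" using a by real_asymp
    ultimately have "(\<lambda>m. exp (- (a / \<epsilon> m))) \<longlonglongrightarrow> 0" by (rule filterlim_compose[rotated])
    from tendsto_mult_right_zero[OF this]
    show "(\<lambda>m. sqrt 2 ^ CARD('n) * M * exp (- (a / \<epsilon> m))) \<longlonglongrightarrow> 0" .
  qed (auto intro!: always_eventually heat_kernel_nonneg \<epsilon>)
qed

lemma lborel_integral_scale_translate:
  fixes f :: "'a :: euclidean_space \<Rightarrow> 'b :: {banach, second_countable_topology}" and r :: real
  assumes [measurable]: "f \<in> borel_measurable borel" and r: "r > 0"
  shows "(LINT y|lborel. f y) = (LINT z|lborel. r ^ DIM('a) *\<^sub>R f (x + r *\<^sub>R z))"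
proof -
  have "(LINT y|lborel. f y) = (LINT y|density (distr lborel borel (\<lambda>z. x + r *\<^sub>R z)) (\<lambda>_. ennreal (\<bar>r\<bar> ^ DIM('a))). f y)"
    using r by (subst lborel_affine[of r x]) auto
  also have "\<dots> = (LINT y|distr lborel borel (\<lambda>z. x + r *\<^sub>R z). \<bar>r\<bar> ^ DIM('a) *\<^sub>R f y)"
    by (subst integral_density) auto
  also have "\<dots> = (LINT z|lborel. \<bar>r\<bar> ^ DIM('a) *\<^sub>R f (x + r *\<^sub>R z))"
    by (subst integral_distr) auto
  finally show ?thesis using r by simp
qed

text \<open>An integrable function need not be bounded, so the integral is split at the unit sphere around \<open>x\<close>.
  Inside, rescaling gives the dominated convergence of \<open>G (x + r m *\<^sub>R z)\<close> against the fixed kernel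
  \<open>heat_kernel z 1\<close>; outside, the kernel is bounded uniformly in time and vanishes pointwise.\<close>
lemma heat_kernel_approximate_identity:
  fixes G :: "real ^ 'n \<Rightarrow> complex" and x :: "real ^ 'n"
  assumes cont: "continuous_on UNIV G" and int: "integrable lborel G"
    and r: "\<And>m. r m > 0" "r \<longlonglongrightarrow> 0"
  shows "(\<lambda>m. LINT y|lborel. G y * of_real (heat_kernel (y - x) ((r m)\<^sup>2))) \<longlonglongrightarrow> G x"
proof -
  have [measurable]: "G \<in> borel_measurable borel" using cont by (rule borel_measurable_continuous_onI)
  have r2: "(r m)\<^sup>2 > 0" for m using r(1)[of m] by simp
  have r2': "(\<lambda>m. (r m)\<^sup>2) \<longlonglongrightarrow> 0" using tendsto_power[OF r(2), of 2] by simp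
  obtain M where M: "\<And>e (w :: real ^ 'n). e > 0 \<Longrightarrow> norm w \<ge> 1 \<Longrightarrow> heat_kernel w e \<le> M"
    using heat_kernel_bounded_away[of 1] by auto
  have M0: "M \<ge> 0"
  proof -
    obtain w :: "real ^ 'n" where "norm w = 1" using vector_choose_size[of 1] by auto
    then show ?thesis using M[of 1 w] heat_kernel_nonneg[of 1 w] by auto
  qed
  have far_bound: "norm (indicator (- ball x 1) y *\<^sub>R (G y * of_real (heat_kernel (y - x) ((r m)\<^sup>2)))) \<le> norm (G y) * M" for m y
  proof (cases "y \<in> ball x 1")
    case False
    then have "heat_kernel (y - x) ((r m)\<^sup>2) \<le> M" using r2 by (intro M) (auto simp: dist_norm norm_minus_commute)
    then show ?thesis using heat_kernel_nonneg[OF r2, of "y - x" m] False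
      by (simp add: norm_mult mult_left_mono)
  qed (use M0 in simp)
  have far_int: "integrable lborel (\<lambda>y. indicator (- ball x 1) y *\<^sub>R (G y * of_real (heat_kernel (y - x) ((r m)\<^sup>2))))" for m
  proof (rule Bochner_Integration.integrable_bound)
    show "integrable lborel (\<lambda>y. norm (G y) * M)" using int by auto
    show "AE y in lborel. norm (indicator (- ball x 1) y *\<^sub>R (G y * of_real (heat_kernel (y - x) ((r m)\<^sup>2)))) \<le> norm (norm (G y) * M)"
      using far_bound[of _ m] M0 by (auto intro!: always_eventually)
  qed measurable
  have far: "(\<lambda>m. LINT y|lborel. indicator (- ball x 1) y *\<^sub>R (G y * of_real (heat_kernel (y - x) ((r m)\<^sup>2)))) \<longlonglongrightarrow> (LINT y|(lborel :: (real ^ 'n) measure). 0)"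
  proof (rule integral_dominated_convergence[where w = "\<lambda>y. norm (G y) * M"])
    show "integrable lborel (\<lambda>y. norm (G y) * M)" using int by auto
    show "AE y in lborel. (\<lambda>m. indicator (- ball x 1) y *\<^sub>R (G y * of_real (heat_kernel (y - x) ((r m)\<^sup>2)))) \<longlonglongrightarrow> 0"
    proof (intro always_eventually allI)
      fix y
      show "(\<lambda>m. indicator (- ball x 1) y *\<^sub>R (G y * of_real (heat_kernel (y - x) ((r m)\<^sup>2)))) \<longlonglongrightarrow> 0"
      proof (cases "y = x")
        case False
        then have "(\<lambda>m. heat_kernel (y - x) ((r m)\<^sup>2)) \<longlonglongrightarrow> 0"
          by (intro heat_kernel_vanishes r2 r2') auto
        then have "(\<lambda>m. indicator (- ball x 1) y *\<^sub>R (G y * of_real (heat_kernel (y - x) ((r m)\<^sup>2)))) \<longlonglongrightarrow> indicator (- ball x 1) y *\<^sub>R (G y * of_real 0)"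
          by (intro tendsto_intros)
        then show ?thesis by simp
      qed simp
    qed
    show "AE y in lborel. norm (indicator (- ball x 1) y *\<^sub>R (G y * of_real (heat_kernel (y - x) ((r m)\<^sup>2)))) \<le> norm (G y) * M" for m
      using far_bound by (auto intro!: always_eventually)
  qed measurable
  obtain B where B: "\<And>y. y \<in> cball x 1 \<Longrightarrow> norm (G y) \<le> B"
  proof -
    have "compact (G ` cball x 1)" by (intro compact_continuous_image continuous_on_subset[OF cont]) auto
    then have "bounded (G ` cball x 1)" by (rule compact_imp_bounded)
    then show ?thesis using that unfolding bounded_iff by blast
  qed
  have B0: "B \<ge> 0" using B[of x] by (meson centre_in_cball norm_ge_zero order_trans zero_le_one)
  define g where "g m z = indicator (ball x 1) (x + r m *\<^sub>R z) *\<^sub>R (G (x + r m *\<^sub>R z) * of_real (heat_kernel z 1))" for m z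
  have [measurable]: "g m \<in> borel_measurable borel" for m
  proof -
    have affine: "(\<lambda>z. x + r m *\<^sub>R z) \<in> measurable borel borel"
      by (intro borel_measurable_continuous_onI continuous_intros)
    have [measurable]: "(\<lambda>z. G (x + r m *\<^sub>R z)) \<in> borel_measurable borel"
      by (rule measurable_compose[OF affine]) measurable
    have [measurable]: "(\<lambda>z. indicator (ball x 1) (x + r m *\<^sub>R z) :: real) \<in> borel_measurable borel"
      by (rule measurable_compose[OF affine]) (intro borel_measurable_indicator borel_open open_ball)
    show ?thesis unfolding g_def
      by (intro borel_measurable_scaleR borel_measurable_times borel_measurable_of_real) measurable
  qed
  have meas: "(\<lambda>y. indicator (ball x 1) y *\<^sub>R (G y * of_real (heat_kernel (y - x) ((r m)\<^sup>2)))) \<in> borel_measurable borel" for m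
    by (intro borel_measurable_scaleR borel_measurable_indicator borel_open open_ball
        borel_measurable_times borel_measurable_of_real) measurable
  have g_eq: "(LINT y|lborel. indicator (ball x 1) y *\<^sub>R (G y * of_real (heat_kernel (y - x) ((r m)\<^sup>2)))) = (LINT z|lborel. g m z)" for m
  proof -
    have "(LINT y|lborel. indicator (ball x 1) y *\<^sub>R (G y * of_real (heat_kernel (y - x) ((r m)\<^sup>2)))) =
      (LINT z|lborel. r m ^ CARD('n) *\<^sub>R (indicator (ball x 1) (x + r m *\<^sub>R z) *\<^sub>R (G (x + r m *\<^sub>R z) * of_real (heat_kernel ((x + r m *\<^sub>R z) - x) ((r m)\<^sup>2)))))"
      by (subst lborel_integral_scale_translate[OF meas r(1)[of m], where x = x]) simp
    also have "\<dots> = (LINT z|lborel. g m z)"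
    proof -
      have "c *\<^sub>R (i *\<^sub>R (a * of_real b)) = i *\<^sub>R (a * of_real (c * b))" for i b c :: real and a :: complex
        by (simp add: scaleR_conv_of_real mult_ac)
      then show ?thesis
        by (simp only: g_def add_diff_cancel_left' heat_kernel_scale[OF r(1)])
    qed
    finally show ?thesis .
  qed
  have g_bound: "norm (g m z) \<le> B * heat_kernel z 1" for m z
  proof (cases "x + r m *\<^sub>R z \<in> ball x 1")
    case True
    then have "norm (G (x + r m *\<^sub>R z)) \<le> B" by (intro B) auto
    then show ?thesis using True heat_kernel_nonneg[of 1 z] by (simp add: g_def norm_mult mult_right_mono)
  qed (use B0 heat_kernel_nonneg[of 1 z] in \<open>simp add: g_def\<close>)
  have near: "(\<lambda>m. LINT z|lborel. g m z) \<longlonglongrightarrow> (LINT z|lborel. G x * of_real (heat_kernel (z :: real ^ 'n) 1))"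
  proof (rule integral_dominated_convergence[where w = "\<lambda>z :: real ^ 'n. B * heat_kernel z 1"])
    show "integrable lborel (\<lambda>z :: real ^ 'n. B * heat_kernel z 1)" using heat_kernel_mass(1) by auto
    show "AE z in lborel. (\<lambda>m. g m z) \<longlonglongrightarrow> G x * of_real (heat_kernel z 1)"
    proof (intro always_eventually allI)
      fix z
      have lim: "(\<lambda>m. x + r m *\<^sub>R z) \<longlonglongrightarrow> x"
        using tendsto_add[OF tendsto_const tendsto_scaleR[OF r(2) tendsto_const], of x z] by simp
      have "(\<lambda>m. G (x + r m *\<^sub>R z)) \<longlonglongrightarrow> G x"
        using continuous_on_tendsto_compose[OF cont lim] by simp
      then have "(\<lambda>m. G (x + r m *\<^sub>R z) * of_real (heat_kernel z 1)) \<longlonglongrightarrow> G x * of_real (heat_kernel z 1)"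
        by (intro tendsto_intros)
      moreover have "eventually (\<lambda>m. x + r m *\<^sub>R z \<in> ball x 1) sequentially"
        using lim by (rule topological_tendstoD) auto
      then have "eventually (\<lambda>m. G (x + r m *\<^sub>R z) * of_real (heat_kernel z 1) = g m z) sequentially"
        by eventually_elim (simp add: g_def)
      ultimately show "(\<lambda>m. g m z) \<longlonglongrightarrow> G x * of_real (heat_kernel z 1)"
        by (rule Lim_transform_eventually)
    qed
    show "AE z in lborel. norm (g m z) \<le> B * heat_kernel z 1" for m
      using g_bound by (auto intro!: always_eventually)
  qed measurable
  have near_int: "integrable lborel (\<lambda>y. indicator (ball x 1) y *\<^sub>R (G y * of_real (heat_kernel (y - x) ((r m)\<^sup>2))))" for m
  proof (rule Bochner_Integration.integrable_bound)
    show "integrable lborel (\<lambda>y. norm (G y) * (1 / sqrt (4 * pi * (r m)\<^sup>2) ^ CARD('n)))" using int by auto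
    have "norm (indicator (ball x 1) y *\<^sub>R (G y * of_real (heat_kernel (y - x) ((r m)\<^sup>2)))) \<le> norm (norm (G y) * (1 / sqrt (4 * pi * (r m)\<^sup>2) ^ CARD('n)))" for y
    proof -
      have "heat_kernel (y - x) ((r m)\<^sup>2) \<le> 1 / sqrt (4 * pi * (r m)\<^sup>2) ^ CARD('n) * 1"
        unfolding heat_kernel_def by (intro mult_left_mono) auto
      then have "norm (G y) * heat_kernel (y - x) ((r m)\<^sup>2) \<le> norm (G y) * (1 / sqrt (4 * pi * (r m)\<^sup>2) ^ CARD('n))"
        by (intro mult_left_mono) auto
      then show ?thesis using heat_kernel_nonneg[OF r2, of "y - x" m]
        by (auto simp: norm_mult indicator_def)
    qed
    then show "AE y in lborel. norm (indicator (ball x 1) y *\<^sub>R (G y * of_real (heat_kernel (y - x) ((r m)\<^sup>2)))) \<le> norm (norm (G y) * (1 / sqrt (4 * pi * (r m)\<^sup>2) ^ CARD('n)))"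
      by (auto intro!: always_eventually)
  qed (use meas in simp)
  have "(LINT y|lborel. G y * of_real (heat_kernel (y - x) ((r m)\<^sup>2))) = (LINT z|lborel. g m z) +
     (LINT y|lborel. indicator (- ball x 1) y *\<^sub>R (G y * of_real (heat_kernel (y - x) ((r m)\<^sup>2))))" for m
    unfolding g_eq[symmetric] Bochner_Integration.integral_add[OF near_int far_int, symmetric]
    by (intro Bochner_Integration.integral_cong) (auto simp: indicator_def)
  then show ?thesis using tendsto_add[OF near far] heat_kernel_mass(2)[where 'n = 'n] by simp
qed

section \<open>Subordination\<close>

text \<open>The multiplication formula for the Fourier transform, applied to \<open>G\<close> and a modulated Gaussian.\<close>
lemma heat_kernel_convolution:
  fixes G :: "real ^ 'n \<Rightarrow> complex"
  assumes int: "integrable lborel G" and \<epsilon>: "\<epsilon> > 0"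
  shows "of_real ((2 * pi) ^ CARD('n)) * (LINT y|lborel. G y * of_real (heat_kernel (y - x) \<epsilon>))
    = (LINT \<kappa>|lborel. exp (- \<i> * of_real (\<kappa> \<bullet> x)) * of_real (exp (- \<epsilon> * (norm \<kappa>)\<^sup>2)) * fourier G \<kappa>)"
proof -
  define h where "h y \<kappa> = G y * (exp (\<i> * of_real (\<kappa> \<bullet> (y - x))) * of_real (exp (- \<epsilon> * (norm \<kappa>)\<^sup>2)))" for y \<kappa>
  have [measurable]: "G \<in> borel_measurable borel" using int by (auto simp: integrable_iff_bounded)
  have "of_real ((2 * pi) ^ CARD('n)) * (LINT y|lborel. G y * of_real (heat_kernel (y - x) \<epsilon>))
     = (LINT y|lborel. G y * of_real ((2 * pi) ^ CARD('n) * heat_kernel (y - x) \<epsilon>))"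
    by (subst integral_mult_right_zero[symmetric]) (simp add: mult_ac)
  also have "\<dots> = (LINT y|lborel. LINT \<kappa>|lborel. h y \<kappa>)"
    unfolding heat_kernel_fourier[OF \<epsilon>, symmetric] h_def by simp
  also have "\<dots> = (LINT \<kappa>|lborel. LINT y|lborel. h y \<kappa>)"
  proof (rule integral_swap_dominated)
    show "(\<lambda>(y, \<kappa>). h y \<kappa>) \<in> borel_measurable (lborel \<Otimes>\<^sub>M lborel)"
      unfolding h_def by measurable
    show "integrable lborel (\<lambda>y. norm (G y))" using int by auto
    show "integrable lborel (\<lambda>\<kappa> :: real ^ 'n. exp (- \<epsilon> * (norm \<kappa>)\<^sup>2))" using \<epsilon> by (rule gaussian_integrable)
    show "norm (h y \<kappa>) \<le> norm (G y) * exp (- \<epsilon> * (norm \<kappa>)\<^sup>2)" for y \<kappa>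
      by (simp add: h_def norm_mult)
  qed
  also have "\<dots> = (LINT \<kappa>|lborel. exp (- \<i> * of_real (\<kappa> \<bullet> x)) * of_real (exp (- \<epsilon> * (norm \<kappa>)\<^sup>2)) * fourier G \<kappa>)"
  proof (rule Bochner_Integration.integral_cong)
    fix \<kappa> :: "real ^ 'n"
    have "h y \<kappa> = exp (- \<i> * of_real (\<kappa> \<bullet> x)) * of_real (exp (- \<epsilon> * (norm \<kappa>)\<^sup>2)) * (exp (\<i> * of_real (\<kappa> \<bullet> y)) * G y)" for y
      by (simp add: h_def inner_diff_right right_diff_distrib exp_diff exp_minus field_simps)
    then show "(LINT y|lborel. h y \<kappa>) = exp (- \<i> * of_real (\<kappa> \<bullet> x)) * of_real (exp (- \<epsilon> * (norm \<kappa>)\<^sup>2)) * fourier G \<kappa>"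
      unfolding fourier_def by simp
  qed simp
  finally show ?thesis .
qed

text \<open>At every nonzero frequency the Laplace transform of the density at \<open>(norm \<kappa>)\<^sup>2\<close> is the fractional
  symbol, so the latter is a mixture of Gaussians. The extra factor
  \<open>exp (- \<epsilon> * (norm \<kappa>)\<^sup>2)\<close> makes the double integral absolutely convergent; without it,
  integrating the Gaussians over all frequencies would leave a singular factor \<open>s powr (- n / 2)\<close>,
  with \<open>n\<close> the dimension, against a density that is only known to be bounded near \<open>0\<close>.\<close>
lemma fourier_inverse_subordinated:
  fixes x :: "real ^ 'n"
  assumes \<beta>: "0 < \<beta>" "\<beta> < 1" and t: "t > 0" and \<epsilon>: "\<epsilon> > 0"
  shows "(LINT \<kappa>|lborel. exp (- \<i> * of_real (\<kappa> \<bullet> x)) * of_real (exp (- \<epsilon> * (norm \<kappa>)\<^sup>2)) * of_real (exp (- (norm \<kappa> powr (2 * \<beta>)) * t)))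
    = of_real ((2 * pi) ^ CARD('n)) * (LINT s:{0<..}|lborel. of_real (subordinator_density \<beta> t s * heat_kernel x (s + \<epsilon>)))"
proof -
  define p where "p s = indicator {0<..} s * subordinator_density \<beta> t s" for s
  have p_int: "integrable lborel p"
    using subordinator_density_integrable[OF \<beta> t] by (simp add: set_integrable_def p_def[abs_def])
  have [measurable]: "p \<in> borel_measurable borel" unfolding p_def by measurable
  define h where "h \<kappa> s = exp (- \<i> * of_real (\<kappa> \<bullet> x)) * of_real (exp (- (\<epsilon> + s) * (norm \<kappa>)\<^sup>2) * p s)" for \<kappa> s
  have "(LINT \<kappa>|lborel. exp (- \<i> * of_real (\<kappa> \<bullet> x)) * of_real (exp (- \<epsilon> * (norm \<kappa>)\<^sup>2)) * of_real (exp (- (norm \<kappa> powr (2 * \<beta>)) * t)))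
     = (LINT \<kappa>|lborel. LINT s|lborel. h \<kappa> s)"
  proof (rule integral_cong_AE)
    have "AE \<kappa> in lborel. \<kappa> \<noteq> (0 :: real ^ 'n)" by (rule AE_lborel_singleton)
    then show "AE \<kappa> in lborel. exp (- \<i> * of_real (\<kappa> \<bullet> x)) * of_real (exp (- \<epsilon> * (norm \<kappa>)\<^sup>2)) * of_real (exp (- (norm \<kappa> powr (2 * \<beta>)) * t))
        = (LINT s|lborel. h \<kappa> s)"
    proof eventually_elim
      fix \<kappa> :: "real ^ 'n" assume \<kappa>: "\<kappa> \<noteq> 0"
      have "exp (- (norm \<kappa> powr (2 * \<beta>)) * t) = exp (- t * ((norm \<kappa>)\<^sup>2) powr \<beta>)"
        using \<kappa> by (simp add: powr_powr flip: powr_numeral)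
      also have "\<dots> = (LINT s|lborel. exp (- (norm \<kappa>)\<^sup>2 * s) * p s)"
        using subordinator_density_laplace[OF \<beta> t, of "(norm \<kappa>)\<^sup>2"] \<kappa>
        by (simp add: set_lebesgue_integral_def p_def mult_ac)
      finally have "complex_of_real (exp (- (norm \<kappa> powr (2 * \<beta>)) * t)) = (LINT s|lborel. of_real (exp (- (norm \<kappa>)\<^sup>2 * s) * p s))"
        by (simp only: integral_complex_of_real)
      moreover have "h \<kappa> s = exp (- \<i> * of_real (\<kappa> \<bullet> x)) * of_real (exp (- \<epsilon> * (norm \<kappa>)\<^sup>2)) * of_real (exp (- (norm \<kappa>)\<^sup>2 * s) * p s)" for s
      proof -
        have "exp (- (\<epsilon> + s) * (norm \<kappa>)\<^sup>2) = exp (- \<epsilon> * (norm \<kappa>)\<^sup>2) * exp (- (norm \<kappa>)\<^sup>2 * s)"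
          by (simp add: algebra_simps flip: exp_add)
        then show ?thesis by (simp only: h_def of_real_mult mult.assoc)
      qed
      ultimately show "exp (- \<i> * of_real (\<kappa> \<bullet> x)) * of_real (exp (- \<epsilon> * (norm \<kappa>)\<^sup>2)) * of_real (exp (- (norm \<kappa> powr (2 * \<beta>)) * t))
        = (LINT s|lborel. h \<kappa> s)"
        by (simp only: integral_mult_right_zero)
    qed
    have "(\<lambda>(\<kappa>, s). h \<kappa> s) \<in> borel_measurable (lborel \<Otimes>\<^sub>M lborel)"
      unfolding h_def by measurable
    then show "(\<lambda>\<kappa>. LINT s|lborel. h \<kappa> s) \<in> borel_measurable lborel"
      by (intro lborel.borel_measurable_lebesgue_integral) auto
  qed measurable
  also have "\<dots> = (LINT s|lborel. LINT \<kappa>|lborel. h \<kappa> s)"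
  proof (rule integral_swap_dominated)
    show "(\<lambda>(\<kappa>, s). h \<kappa> s) \<in> borel_measurable (lborel \<Otimes>\<^sub>M lborel)"
      unfolding h_def by measurable
    show "integrable lborel (\<lambda>\<kappa> :: real ^ 'n. exp (- \<epsilon> * (norm \<kappa>)\<^sup>2))" using \<epsilon> by (rule gaussian_integrable)
    show "integrable lborel (\<lambda>s. \<bar>p s\<bar>)" using p_int by auto
    fix \<kappa> s
    show "norm (h \<kappa> s) \<le> exp (- \<epsilon> * (norm \<kappa>)\<^sup>2) * \<bar>p s\<bar>"
    proof (cases "s > 0")
      case True
      then have "- (\<epsilon> + s) * (norm \<kappa>)\<^sup>2 \<le> - \<epsilon> * (norm \<kappa>)\<^sup>2" by (intro mult_right_mono) auto
      then have "exp (- (\<epsilon> + s) * (norm \<kappa>)\<^sup>2) \<le> exp (- \<epsilon> * (norm \<kappa>)\<^sup>2)" by (simp only: exp_le_cancel_iff)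
      then show ?thesis by (simp add: h_def norm_mult abs_mult mult_right_mono)
    qed (simp add: h_def p_def)
  qed
  also have "\<dots> = (LINT s|lborel. of_real ((2 * pi) ^ CARD('n)) * of_real (p s * heat_kernel x (s + \<epsilon>)))"
  proof (rule Bochner_Integration.integral_cong)
    fix s
    show "(LINT \<kappa>|lborel. h \<kappa> s) = of_real ((2 * pi) ^ CARD('n)) * of_real (p s * heat_kernel x (s + \<epsilon>))"
    proof (cases "s > 0")
      case True
      have "(LINT \<kappa>|lborel. h \<kappa> s) = (LINT \<kappa>|lborel. of_real (p s) * (exp (\<i> * of_real (\<kappa> \<bullet> (- x))) * of_real (exp (- (\<epsilon> + s) * (norm \<kappa>)\<^sup>2))))"
        by (intro Bochner_Integration.integral_cong) (auto simp: h_def mult_ac)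
      also have "\<dots> = of_real (p s) * of_real ((2 * pi) ^ CARD('n) * heat_kernel (- x) (\<epsilon> + s))"
        using True \<epsilon> by (subst heat_kernel_fourier[symmetric]) auto
      finally show ?thesis by (simp add: heat_kernel_minus add.commute mult_ac)
    qed (simp add: h_def p_def)
  qed simp
  also have "\<dots> = of_real ((2 * pi) ^ CARD('n)) * (LINT s|lborel. of_real (p s * heat_kernel x (s + \<epsilon>)))"
    by (rule integral_mult_right_zero)
  also have "(LINT s|lborel. complex_of_real (p s * heat_kernel x (s + \<epsilon>))) = (LINT s:{0<..}|lborel. of_real (subordinator_density \<beta> t s * heat_kernel x (s + \<epsilon>)))"
    unfolding set_lebesgue_integral_def by (intro Bochner_Integration.integral_cong) (auto simp: p_def indicator_def)
  finally show ?thesis .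
qed

text \<open>Both sides are compared after smoothing by the heat kernel at time \<open>\<epsilon>\<close>. As \<open>\<epsilon>\<close> tends to \<open>0\<close>
  the smoothed \<open>G\<close> tends to \<open>G x\<close> by continuity, and the right-hand side converges by dominated
  convergence, since \<open>heat_kernel x\<close> is bounded when \<open>x \<noteq> 0\<close> and the density is integrable.\<close>
lemma subordination_formula:
  fixes G :: "real ^ 'n \<Rightarrow> complex" and x :: "real ^ 'n"
  assumes \<beta>: "0 < \<beta>" "\<beta> < 1" and t: "t > 0" and x: "x \<noteq> 0"
    and cont: "continuous_on UNIV G" and int: "integrable lborel G"
    and G: "\<And>\<kappa>. fourier G \<kappa> = of_real (exp (- (norm \<kappa> powr (2 * \<beta>)) * t))"
  shows "set_integrable lborel {0<..} (\<lambda>s. of_real (subordinator_density \<beta> t s * heat_kernel x s) :: complex)"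
    and "G x = (LINT s:{0<..}|lborel. of_real (subordinator_density \<beta> t s * heat_kernel x s))"
proof -
  obtain M where M: "\<And>e. e > 0 \<Longrightarrow> heat_kernel x e \<le> M"
    using heat_kernel_bounded_away[of "norm x"] x by auto
  define p where "p s = indicator {0<..} s * subordinator_density \<beta> t s" for s
  have p_int: "integrable lborel p"
    using subordinator_density_integrable[OF \<beta> t] by (simp add: set_integrable_def p_def[abs_def])
  have [measurable]: "p \<in> borel_measurable borel" unfolding p_def by measurable
  have p0: "p s = 0" if "s \<le> 0" for s using that by (simp add: p_def)
  have bound: "norm (complex_of_real (p s * heat_kernel x (s + e))) \<le> \<bar>p s\<bar> * M" if "e \<ge> 0" for s e
  proof (cases "s > 0")
    case True
    then show ?thesis using M[of "s + e"] heat_kernel_nonneg[of "s + e" x] that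
      unfolding norm_of_real abs_mult by (intro mult_left_mono) auto
  qed (simp add: p0)
  have p_eq: "indicator {0<..} s *\<^sub>R complex_of_real (subordinator_density \<beta> t s * heat_kernel x u) = of_real (p s * heat_kernel x u)" for s u
    by (simp add: p_def indicator_def)
  have bi: "integrable lborel (\<lambda>s. \<bar>p s\<bar> * M)" using p_int by auto
  have "integrable lborel (\<lambda>s. complex_of_real (p s * heat_kernel x s))"
    by (rule Bochner_Integration.integrable_bound[OF bi])
       (use bound[of 0] in \<open>auto intro!: always_eventually order_trans[OF bound[of 0, simplified] abs_ge_self]\<close>)
  then show "set_integrable lborel {0<..} (\<lambda>s. of_real (subordinator_density \<beta> t s * heat_kernel x s) :: complex)"
    by (simp only: set_integrable_def p_eq)
  define r where "r m = 1 / real (Suc m)" for m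
  have r: "r m > 0" "r \<longlonglongrightarrow> 0" for m
    using LIMSEQ_inverse_real_of_nat by (auto simp: r_def[abs_def] inverse_eq_divide)
  have r2: "(\<lambda>m. (r m)\<^sup>2) \<longlonglongrightarrow> 0" using tendsto_power[OF r(2), of 2] by simp
  have eq: "(LINT y|lborel. G y * of_real (heat_kernel (y - x) ((r m)\<^sup>2))) = (LINT s|lborel. of_real (p s * heat_kernel x (s + (r m)\<^sup>2)))" for m
  proof -
    have r2: "(r m)\<^sup>2 > 0" using r(1)[of m] by simp
    have "complex_of_real ((2 * pi) ^ CARD('n)) * (LINT y|lborel. G y * of_real (heat_kernel (y - x) ((r m)\<^sup>2)))
      = of_real ((2 * pi) ^ CARD('n)) * (LINT s:{0<..}|lborel. of_real (subordinator_density \<beta> t s * heat_kernel x (s + (r m)\<^sup>2)))"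
      unfolding heat_kernel_convolution[OF int r2] G fourier_inverse_subordinated[OF \<beta> t r2] ..
    moreover have "complex_of_real ((2 * pi) ^ CARD('n)) \<noteq> 0" by simp
    ultimately show ?thesis
      unfolding set_lebesgue_integral_def p_eq mult_cancel_left by blast
  qed
  have "(\<lambda>m. LINT s|lborel. complex_of_real (p s * heat_kernel x (s + (r m)\<^sup>2))) \<longlonglongrightarrow> (LINT s|lborel. complex_of_real (p s * heat_kernel x s))"
  proof (rule integral_dominated_convergence[OF _ _ bi])
    show "AE s in lborel. (\<lambda>m. complex_of_real (p s * heat_kernel x (s + (r m)\<^sup>2))) \<longlonglongrightarrow> of_real (p s * heat_kernel x s)"
    proof (intro always_eventually allI)
      fix s
      show "(\<lambda>m. complex_of_real (p s * heat_kernel x (s + (r m)\<^sup>2))) \<longlonglongrightarrow> of_real (p s * heat_kernel x s)"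
        by (cases "s > 0") (auto simp: p0 simp del: of_real_mult intro!: tendsto_intros heat_kernel_tendsto r2)
    qed
    show "AE s in lborel. norm (complex_of_real (p s * heat_kernel x (s + (r m)\<^sup>2))) \<le> \<bar>p s\<bar> * M" for m
      using bound by (intro always_eventually allI) simp
  qed measurable
  moreover have "(\<lambda>m. LINT s|lborel. complex_of_real (p s * heat_kernel x (s + (r m)\<^sup>2))) \<longlonglongrightarrow> G x"
    unfolding eq[symmetric] by (rule heat_kernel_approximate_identity[OF cont int r])
  ultimately have "G x = (LINT s|lborel. complex_of_real (p s * heat_kernel x s))"
    by (rule LIMSEQ_unique[rotated])
  then show "G x = (LINT s:{0<..}|lborel. of_real (subordinator_density \<beta> t s * heat_kernel x s))"
    by (simp only: set_lebesgue_integral_def p_eq)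
qed

theorem mainTheorem2:
  fixes \<alpha> :: real and G :: "real ^ 'n \<Rightarrow> real \<Rightarrow> complex"
    and x :: "real ^ 'n" and t :: real
  assumes "0 < \<alpha>" and "\<alpha> < 2"
    and "fundamental_solution \<alpha> G"
    and "x \<noteq> 0" and "t > 0"
  shows "set_integrable lborel {0<..} (\<lambda>s. of_real (inverse s) *
            Wright 0 (- \<alpha> / 2) (of_real (- (s powr (- \<alpha> / 2)) * t)) *
            of_real (heat_kernel x s))
      \<and> G x t = (LINT s:{0<..}|lborel. of_real (inverse s) *
            Wright 0 (- \<alpha> / 2) (of_real (- (s powr (- \<alpha> / 2)) * t)) *
            of_real (heat_kernel x s))"
proof -
  define \<beta> where "\<beta> = \<alpha> / 2"
  have \<beta>: "0 < \<beta>" "\<beta> < 1" and \<alpha>: "- \<alpha> / 2 = - \<beta>" "2 * \<beta> = \<alpha>"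
    using assms by (auto simp: \<beta>_def)
  have G: "continuous_on UNIV (\<lambda>x. G x t)" "integrable lborel (\<lambda>x. G x t)"
    "\<And>\<kappa>. fourier (\<lambda>x. G x t) \<kappa> = of_real (exp (- (norm \<kappa> powr (2 * \<beta>)) * t))"
    using assms(3,5) unfolding fundamental_solution_def \<alpha> by auto
  have W: "of_real (inverse s) * Wright 0 (- \<alpha> / 2) (of_real (- (s powr (- \<alpha> / 2)) * t)) * of_real (heat_kernel x s)
      = complex_of_real (subordinator_density \<beta> t s * heat_kernel x s)" if "s \<in> {0<..}" for s
    unfolding \<alpha> of_real_mult using that \<beta> assms(5) by (subst Wright_eq_subordinator_density[symmetric]) auto
  note sub = subordination_formula[OF \<beta> assms(5,4) G]
  show ?thesis
  proof
    show "set_integrable lborel {0<..} (\<lambda>s. of_real (inverse s) *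
            Wright 0 (- \<alpha> / 2) (of_real (- (s powr (- \<alpha> / 2)) * t)) *
            of_real (heat_kernel x s))"
      by (rule iffD2[OF set_integrable_cong[OF refl refl W] sub(1)])
    show "G x t = (LINT s:{0<..}|lborel. of_real (inverse s) *
            Wright 0 (- \<alpha> / 2) (of_real (- (s powr (- \<alpha> / 2)) * t)) *
            of_real (heat_kernel x s))"
      unfolding sub(2) by (intro set_lebesgue_integral_cong allI impI W[symmetric]) auto
  qed
qed

end
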